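(* Let $D_1$ be the open unit ball of $\mathbb{R}^2$ and $\kappa>0$. The first (smallest) eigenvalue of $$\Delta^2u-\kappa^2u=-\lambda\Delta u\ \text{ in }D_1,\qquad u=\partial_ru=0\ \text{ on }\partial D_1,$$ is simple and given by $$\lambda_1=\alpha_{0,1}^2-\frac{\kappa^2}{\alpha_{0,1}^2},$$ with corresponding eigenfunctions given by $$R_{0,1}(r)=c\,J_0(\alpha_{0,1}\,r)+d\,I_0\Bigl(\frac{\kappa}{\alpha_{0,1}}\,r\Bigr),$$ where $(c,d)$ is a nontrivial solution to $$\begin{cases} c\,J_0(\alpha)+d\,I_0(\kappa/\alpha)=0,\\ c\,\alpha J_0'(\alpha)+d\,\frac{\kappa}{\alpha}I_0'(\kappa/\alpha)=0,\end{cases}\qquad\text{with }\alpha=\alpha_{0,1}.$$ Moreover $\lambda_1=\lambda_1(\kappa)$ is a decreasing function of $\kappa\in\,]0,+\infty[$, and $$\lim_{\kappa\to0}\lambda_1(\kappa)=j_{1,1}^2\qquad\text{and}\qquad\lim_{\kappa\to\infty}\lambda_1(\kappa)=-\infty.$$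
   Context: $J_k$ (resp. $I_k$) is the Bessel function (resp. modified Bessel function) of the first kind of order $k$, and $(j_{k,\ell})_{\ell\ge1}$ are the positive roots of $J_k$ in increasing order. For $\kappa>0$, $\alpha_{0,1}=\alpha_{0,1}(\kappa)$ denotes the smallest positive root of $$F_0(\alpha)=\frac{\kappa}{\alpha}J_0(\alpha)I_0'\Bigl(\frac{\kappa}{\alpha}\Bigr)-\alpha I_0\Bigl(\frac{\kappa}{\alpha}\Bigr)J_0'(\alpha),\qquad\alpha>0.$$ An eigenvalue is a $\lambda\in\mathbb{R}$ for which the problem has a nontrivial solution; it is simple if its eigenspace is one-dimensional. *)

theory Defs
  imports "HOL-Analysis.Analysis" "HOL-Library.Function_Algebras"
begin

section \<open>Bessel functions\<close>

definition bessel_J :: "nat \<Rightarrow> real \<Rightarrow> real" where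
  "bessel_J k x = (\<Sum>m. (-1) ^ m / (fact m * fact (m + k)) * (x / 2) ^ (2 * m + k))"

definition bessel_I :: "nat \<Rightarrow> real \<Rightarrow> real" where
  "bessel_I k x = (\<Sum>m. 1 / (fact m * fact (m + k)) * (x / 2) ^ (2 * m + k))"

text \<open>For \<open>l \<ge> 1\<close>, \<open>bessel_J_root k l\<close> is the \<open>l\<close>-th positive root of \<open>J\<^sub>k\<close>;
  the value at \<open>l = 0\<close> only starts the recursion.\<close>

fun bessel_J_root :: "nat \<Rightarrow> nat \<Rightarrow> real" where
  "bessel_J_root k 0 = 0"
| "bessel_J_root k (Suc l) = (LEAST x. bessel_J_root k l < x \<and> bessel_J k x = 0)"

definition F0 :: "real \<Rightarrow> real \<Rightarrow> real" where
  "F0 \<kappa> \<alpha> = \<kappa> / \<alpha> * bessel_J 0 \<alpha> * deriv (bessel_I 0) (\<kappa> / \<alpha>)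
            - \<alpha> * bessel_I 0 (\<kappa> / \<alpha>) * deriv (bessel_J 0) \<alpha>"

definition alpha01 :: "real \<Rightarrow> real" where
  "alpha01 \<kappa> = (LEAST \<alpha>. 0 < \<alpha> \<and> F0 \<kappa> \<alpha> = 0)"


section \<open>Functions of class \<open>C\<^sup>k\<close> and the Laplacian\<close>

definition partial_deriv :: "'n \<Rightarrow> (real ^ 'n \<Rightarrow> real) \<Rightarrow> real ^ 'n \<Rightarrow> real" where
  "partial_deriv i f x = frechet_derivative f (at x) (axis i 1)"

text \<open>Intended for open sets \<open>S\<close>.\<close>

fun Ck_on :: "nat \<Rightarrow> (real ^ 'n \<Rightarrow> real) \<Rightarrow> (real ^ 'n) set \<Rightarrow> bool" where
  "Ck_on 0 f S \<longleftrightarrow> continuous_on S f"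
| "Ck_on (Suc k) f S \<longleftrightarrow>
     (\<forall>x\<in>S. f differentiable (at x)) \<and> (\<forall>i. Ck_on k (partial_deriv i f) S)"

text \<open>Class \<open>C\<^sup>1\<close> up to the boundary: \<open>f\<close> is \<open>C\<^sup>1\<close> on the open set \<open>S\<close>, and \<open>f\<close> itself and
  continuous extensions of its first partial derivatives are continuous on the closure.\<close>

definition C1_up_to_boundary :: "(real ^ 'n \<Rightarrow> real) \<Rightarrow> (real ^ 'n) set \<Rightarrow> bool" where
  "C1_up_to_boundary f S \<longleftrightarrow>
     Ck_on 1 f S \<and> continuous_on (closure S) f \<and>
     (\<forall>i. \<exists>g. continuous_on (closure S) g \<and> (\<forall>x\<in>S. g x = partial_deriv i f x))"

definition laplacian :: "(real ^ 'n::finite \<Rightarrow> real) \<Rightarrow> real ^ 'n \<Rightarrow> real" where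
  "laplacian f x = (\<Sum>i\<in>UNIV. partial_deriv i (partial_deriv i f) x)"


section \<open>The eigenvalue problem on the unit disc\<close>

text \<open>Classical solutions. The radial derivative at a boundary point \<open>x\<close>, \<open>norm x = 1\<close>, is the
  one-sided derivative at \<open>t = 1\<close> of \<open>u\<close> along the ray \<open>t x\<close>, taken from inside the disc.\<close>

definition clamped_solution :: "real \<Rightarrow> real \<Rightarrow> (real ^ 2 \<Rightarrow> real) \<Rightarrow> bool" where
  "clamped_solution \<kappa> \<mu> u \<longleftrightarrow>
     Ck_on 4 u (ball 0 1) \<and> C1_up_to_boundary u (ball 0 1) \<and>
     (\<forall>x\<in>ball 0 1. laplacian (laplacian u) x - \<kappa>\<^sup>2 * u x = - \<mu> * laplacian u x) \<and>
     (\<forall>x\<in>sphere 0 1. u x = 0 \<and> ((\<lambda>t. u (t *\<^sub>R x)) has_real_derivative 0) (at_left 1))"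

text \<open>A function on the closed disc is represented by its extension by zero to the plane, so that
  the eigenspace below is a space of functions on the closed disc.\<close>

definition eigenspace :: "real \<Rightarrow> real \<Rightarrow> (real ^ 2 \<Rightarrow> real) set" where
  "eigenspace \<kappa> \<mu> = {u. clamped_solution \<kappa> \<mu> u \<and> (\<forall>x. x \<notin> cball 0 1 \<longrightarrow> u x = 0)}"

definition eigenfunction :: "real \<Rightarrow> real \<Rightarrow> (real ^ 2 \<Rightarrow> real) \<Rightarrow> bool" where
  "eigenfunction \<kappa> \<mu> u \<longleftrightarrow> u \<in> eigenspace \<kappa> \<mu> \<and> (\<exists>x. u x \<noteq> 0)"

definition eigenvalue :: "real \<Rightarrow> real \<Rightarrow> bool" where
  "eigenvalue \<kappa> \<mu> \<longleftrightarrow> (\<exists>u. eigenfunction \<kappa> \<mu> u)"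

interpretation real_fun: vector_space "\<lambda>(c::real) (f :: real ^ 2 \<Rightarrow> real) x. c * f x"
  by unfold_locales (auto simp: fun_eq_iff algebra_simps)

definition simple_eigenvalue :: "real \<Rightarrow> real \<Rightarrow> bool" where
  "simple_eigenvalue \<kappa> \<mu> \<longleftrightarrow> eigenvalue \<kappa> \<mu> \<and> real_fun.dim (eigenspace \<kappa> \<mu>) = 1"

definition first_eigenvalue :: "real \<Rightarrow> real" where
  "first_eigenvalue \<kappa> = (LEAST \<mu>. eigenvalue \<kappa> \<mu>)"

text \<open>The radial function with profile \<open>R\<close> on the closed unit disc.\<close>

definition radial_on_disc :: "(real \<Rightarrow> real) \<Rightarrow> real ^ 2 \<Rightarrow> real" where
  "radial_on_disc R x = (if x \<in> cball 0 1 then R (norm x) else 0)"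

definition boundary_system :: "real \<Rightarrow> real \<Rightarrow> real \<Rightarrow> real \<Rightarrow> bool" where
  "boundary_system \<kappa> \<alpha> c d \<longleftrightarrow>
     c * bessel_J 0 \<alpha> + d * bessel_I 0 (\<kappa> / \<alpha>) = 0 \<and>
     c * \<alpha> * deriv (bessel_J 0) \<alpha> + d * (\<kappa> / \<alpha>) * deriv (bessel_I 0) (\<kappa> / \<alpha>) = 0"

end

theory Submission
  imports Defs
begin

text \<open>With \<open>\<mu> = \<alpha>\<^sup>2 - \<beta>\<^sup>2\<close> and \<open>\<beta> = \<kappa> / \<alpha>\<close> the equation factors as \<open>(\<Delta> + \<alpha>\<^sup>2) (\<Delta> - \<beta>\<^sup>2) u = 0\<close>, so each
  angular Fourier coefficient of a solution is a combination of \<open>J\<^sub>k (\<alpha> r)\<close> and \<open>I\<^sub>k (\<beta> r)\<close>. If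
  \<open>\<alpha> < j\<^sub>1\<^sub>,\<^sub>1\<close>, the boundary conditions force the coefficients with \<open>k \<ge> 1\<close> to vanish, because the
  logarithmic derivative at the boundary of \<open>J\<^sub>k (\<alpha> r)\<close> is below \<open>k\<close> and that of \<open>I\<^sub>k (\<beta> r)\<close> is above \<open>k\<close>.
  A nonzero coefficient with \<open>k = 0\<close> means \<open>F0 \<kappa> \<alpha> = 0\<close>. The first zero of \<open>F0 \<kappa>\<close> lies between
  \<open>j\<^sub>0\<^sub>,\<^sub>1\<close> and \<open>j\<^sub>1\<^sub>,\<^sub>1\<close>, so it gives the first eigenvalue. There \<open>J\<^sub>0\<close> is negative, hence
  raising \<open>\<kappa>\<close> makes \<open>F0\<close> negative at the old zero; so \<open>alpha01\<close> is decreasing, and the limits follow.\<close>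

section \<open>Bessel functions through Bessel--Clifford functions\<close>

text \<open>A solution is \<open>C^4\<close> inside the disc but only \<open>C^1\<close> up to the
  rim, so \<open>\<Delta>u\<close> has no boundary values to integrate by parts with. All
  computations therefore take place at radius r < 1, and the rim enters only through the limits of a
  coefficient and of its first derivative as r tends to 1. At the centre, the singular Bessel
  solutions are excluded by letting r run through negative values as well. For \<kappa> > 0 every
  real \<mu> equals \<open>\<alpha>^2 - \<kappa>^2 / \<alpha>^2\<close> for exactly one \<alpha> >
  0, and the expression increases with \<alpha>. Ordering eigenvalues means ordering \<alpha>, and
  for the smallest one only the range below \<open>j_{1,1}\<close> matters.
  \<open>clifford k t\<close> is the hypergeometric function \<open>0F1(; k+1; t)\<close> divided by
  \<open>k!\<close>. Apart from the factor \<open>(x/2)^k\<close> it is J_k at negative and I_k at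
  positive argument, so both families share one derivative rule and one recurrence, and radial
  functions become smooth functions of \<open>|x|^2\<close>, also at the origin.\<close>

definition clifford :: "nat \<Rightarrow> real \<Rightarrow> real" where
  "clifford k t = (\<Sum>m. 1 / (fact m * fact (m + k)) * t ^ m)"

lemma summable_clifford: "summable (\<lambda>m. 1 / (fact m * fact (m + k)) * (t::real) ^ m)"
proof (rule summable_comparison_test')
  show "summable (\<lambda>m. inverse (fact m) * \<bar>t\<bar> ^ m)"
    by (rule summable_exp)
  show "norm (1 / (fact m * fact (m + k)) * t ^ m) \<le> inverse (fact m) * \<bar>t\<bar> ^ m" for m
  proof -
    have "1 / (fact m * fact (m + k)) \<le> (1::real) / (fact m * 1)"
      by (intro divide_left_mono mult_left_mono) auto
    then show ?thesis
      by (simp add: abs_mult power_abs divide_inverse mult_right_mono)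
  qed
qed

lemma DERIV_clifford: "(clifford k has_real_derivative clifford (Suc k) t) (at t)"
proof -
  have *: "diffs (\<lambda>m. 1 / (fact m * fact (m + k))) n = 1 / (fact n * (fact (n + Suc k) :: real))" for n
  proof -
    have "(fact (Suc n) :: real) = real (Suc n) * fact n"
      by simp
    then show ?thesis
      unfolding diffs_def by (simp del: fact_Suc of_nat_Suc)
  qed
  have "((\<lambda>x. \<Sum>n. 1 / (fact n * fact (n + k)) * x ^ n) has_real_derivative
      (\<Sum>n. diffs (\<lambda>m. 1 / (fact m * fact (m + k))) n * t ^ n)) (at t)"
    by (rule termdiffs_strong_converges_everywhere[OF summable_clifford])
  then show ?thesis
    unfolding * clifford_def[abs_def] .
qed

lemma DERIV_clifford_chain [derivative_intros]:
  assumes "(f has_real_derivative f') (at x within S)"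
  shows "((\<lambda>x. clifford k (f x)) has_real_derivative clifford (Suc k) (f x) * f') (at x within S)"
  using DERIV_chain2[OF DERIV_clifford assms] .

lemma continuous_on_clifford [continuous_intros]:
  assumes "continuous_on S f"
  shows "continuous_on S (\<lambda>x. clifford k (f x))"
proof -
  have "continuous_on UNIV (clifford k)"
    using DERIV_clifford by (meson DERIV_continuous_on has_field_derivative_at_within)
  then show ?thesis
    using assms by (rule continuous_on_compose2) auto
qed

lemma tendsto_clifford [tendsto_intros]:
  assumes "(f \<longlongrightarrow> l) F"
  shows "((\<lambda>x. clifford k (f x)) \<longlongrightarrow> clifford k l) F"
  using isCont_tendsto_compose[OF DERIV_isCont[OF DERIV_clifford] assms] .

lemma clifford_0 [simp]: "clifford k 0 = 1 / fact k"
  unfolding clifford_def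
  by (subst powser_zero[of "\<lambda>m. 1 / (fact m * fact (m + k))"]) simp

lemma clifford_pos:
  assumes "0 \<le> t" shows "0 < clifford k t"
proof -
  have "1 / fact k \<le> clifford k t"
    using sum_le_suminf[OF summable_clifford[of k t], of "{0}"] assms
    unfolding clifford_def by simp
  moreover have "(0::real) < 1 / fact k" by simp
  ultimately show ?thesis by linarith
qed

text \<open>Since differentiation raises the index, this recurrence is the Bessel equation in
  disguise: \<open>t y'' + (k + 1) y' = y\<close> for \<open>y = clifford k\<close>.\<close>

lemma clifford_rec:
  "t * clifford (Suc (Suc k)) t + real (Suc k) * clifford (Suc k) t = clifford k t"
proof -
  let ?c = "\<lambda>k m. 1 / (fact m * fact (m + k)) * t ^ m"
  \<comment> \<open>Multiplication by \<open>t\<close> shifts the power series by one place;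
    \<open>g\<close> is the shifted series with constant term 0, so that coefficients can be
    compared index by index.\<close>
  define g where "g m = (case m of 0 \<Rightarrow> 0 | Suc n \<Rightarrow> t * ?c (Suc (Suc k)) n)" for m
  have "(\<lambda>m. t * ?c (Suc (Suc k)) m) sums (t * clifford (Suc (Suc k)) t)"
    unfolding clifford_def by (intro sums_mult summable_sums summable_clifford)
  then have "(\<lambda>m. g (Suc m)) sums (t * clifford (Suc (Suc k)) t)"
    by (simp add: g_def)
  then have "g sums (t * clifford (Suc (Suc k)) t)"
    using sums_Suc[of g] by (simp add: g_def)
  moreover have "(\<lambda>m. real (Suc k) * ?c (Suc k) m) sums (real (Suc k) * clifford (Suc k) t)"
    unfolding clifford_def by (intro sums_mult summable_sums summable_clifford)
  ultimately have "(\<lambda>m. g m + real (Suc k) * ?c (Suc k) m) sums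
      (t * clifford (Suc (Suc k)) t + real (Suc k) * clifford (Suc k) t)"
    by (rule sums_add)
  moreover have "g m + real (Suc k) * ?c (Suc k) m = ?c k m" for m
  proof (cases m)
    case 0
    then show ?thesis by (simp add: g_def field_simps del: of_nat_Suc)
  next
    case (Suc n)
    define F :: real where "F = fact n"
    define G :: real where "G = fact (Suc n + k)"
    have [simp]: "F \<noteq> 0" "G \<noteq> 0" by (auto simp: F_def G_def)
    have 1: "(fact (Suc n) :: real) = real (Suc n) * F" by (simp add: F_def)
    have 2: "(fact (n + Suc (Suc k)) :: real) = real (Suc n + Suc k) * G"
      "(fact (Suc n + Suc k) :: real) = real (Suc n + Suc k) * G" by (simp_all add: G_def)
    show ?thesis
      unfolding Suc g_def nat.case 1 2 F_def[symmetric] G_def[symmetric]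
      by (simp add: divide_simps) (simp add: algebra_simps)
  qed
  ultimately have "?c k sums (t * clifford (Suc (Suc k)) t + real (Suc k) * clifford (Suc k) t)"
    by simp
  then show ?thesis
    unfolding clifford_def[of k] by (rule sums_unique)
qed

lemma clifford_rec_0: "t * clifford (Suc (Suc 0)) t + clifford (Suc 0) t = clifford 0 t"
  using clifford_rec[of t 0] by simp

lemma bessel_J_eq_clifford: "bessel_J k x = (x / 2) ^ k * clifford k (- (x\<^sup>2 / 4))"
proof -
  have "(-1) ^ m / (fact m * fact (m + k)) * (x / 2) ^ (2 * m + k)
      = (x / 2) ^ k * (1 / (fact m * fact (m + k)) * (- (x\<^sup>2 / 4)) ^ m)" for m
  proof -
    have "(- (x\<^sup>2 / 4)) ^ m = (-1) ^ m * (x / 2) ^ (2 * m)"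
      by (subst power_minus) (simp add: power_mult power_divide)
    then show ?thesis by (simp add: power_add)
  qed
  then show ?thesis
    unfolding bessel_J_def clifford_def by (simp only: suminf_mult[OF summable_clifford])
qed

lemma bessel_I_eq_clifford: "bessel_I k x = (x / 2) ^ k * clifford k (x\<^sup>2 / 4)"
proof -
  have "1 / (fact m * fact (m + k)) * (x / 2) ^ (2 * m + k)
      = (x / 2) ^ k * (1 / (fact m * fact (m + k)) * (x\<^sup>2 / 4) ^ m)" for m
  proof -
    have "(x\<^sup>2 / 4) ^ m = (x / 2) ^ (2 * m)"
      by (simp add: power_mult power_divide)
    then show ?thesis by (simp add: power_add)
  qed
  then show ?thesis
    unfolding bessel_I_def clifford_def by (simp only: suminf_mult[OF summable_clifford])
qed

lemma deriv_bessel_J_0: "deriv (bessel_J 0) x = - (x / 2) * clifford 1 (- (x\<^sup>2 / 4))"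
proof -
  have eq: "bessel_J 0 = (\<lambda>x. clifford 0 (- (x\<^sup>2 / 4)))"
    by (simp add: bessel_J_eq_clifford fun_eq_iff)
  show ?thesis unfolding eq
    by (rule DERIV_imp_deriv) (auto intro!: derivative_eq_intros)
qed

lemma deriv_bessel_I_0: "deriv (bessel_I 0) x = x / 2 * clifford 1 (x\<^sup>2 / 4)"
proof -
  have eq: "bessel_I 0 = (\<lambda>x. clifford 0 (x\<^sup>2 / 4))"
    by (simp add: bessel_I_eq_clifford fun_eq_iff)
  show ?thesis unfolding eq
    by (rule DERIV_imp_deriv) (auto intro!: derivative_eq_intros)
qed

text \<open>The counterpart of \<open>(x^(k+1) J_(k+1))' = x^(k+1) J_k\<close>. Integrated from 0,
  it passes positivity from index k to index k + 1.\<close>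

lemma DERIV_power_clifford:
  "((\<lambda>t. t ^ Suc k * clifford (Suc k) (- t)) has_real_derivative t ^ k * clifford k (- t)) (at t)"
proof -
  have "((\<lambda>t. t ^ Suc k * clifford (Suc k) (- t)) has_real_derivative
     real (Suc k) * t ^ k * clifford (Suc k) (- t) + t ^ Suc k * (clifford (Suc (Suc k)) (- t) * (- 1)))
     (at t)"
    by (auto intro!: derivative_eq_intros simp del: power_Suc)
  also have "real (Suc k) * t ^ k * clifford (Suc k) (- t) + t ^ Suc k * (clifford (Suc (Suc k)) (- t) * (- 1))
     = t ^ k * clifford k (- t)"
    unfolding clifford_rec[of "- t" k, symmetric] by (simp add: algebra_simps)
  finally show ?thesis .
qed

text \<open>This sign change guarantees that J_1 has a positive zero. The value 5 lies safely beyond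
  \<open>j_{1,1}^2 / 4\<close>, which is about 3.67: the first five terms of the series already have
  a negative sum, and the remaining alternating tail only lowers it.\<close>

lemma clifford_1_minus_5: "clifford 1 (- 5) < 0"
proof -
  define f :: "nat \<Rightarrow> real" where "f m = 1 / (fact m * fact (m + 1)) * (- 5) ^ m" for m
  define a :: "nat \<Rightarrow> real" where "a n = 5 ^ (n + 3) / (fact (n + 3) * fact (n + 4))" for n
  have sf: "summable f" unfolding f_def by (rule summable_clifford)
  have fa: "f (n + 3) = - ((-1) ^ n * a n)" for n
  proof -
    have "(- 5 :: real) ^ (n + 3) = (-1) ^ (n + 3) * 5 ^ (n + 3)"
      by (subst power_minus) simp
    then show ?thesis by (simp add: f_def a_def power_add add.commute)
  qed
  have s1: "summable (\<lambda>n. (-1) ^ n * a n)"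
    using summable_minus[OF summable_ignore_initial_segment[OF sf, of 3]]
    by (simp only: fa minus_minus)
  have dec: "a (Suc n) \<le> a n" for n
  proof -
    have "a (Suc n) = a n * (5 / (real (n + 4) * real (n + 5)))"
      by (simp add: a_def fact_reduce divide_simps algebra_simps eval_nat_numeral)
    also have "\<dots> \<le> a n * 1"
    proof (rule mult_left_mono)
      have "4 * 5 \<le> real (n + 4) * real (n + 5)" by (intro mult_mono) auto
      then show "5 / (real (n + 4) * real (n + 5)) \<le> 1" by (simp add: divide_simps)
    qed (simp add: a_def)
    finally show ?thesis by simp
  qed
  have "a \<longlonglongrightarrow> 0"
  proof -
    have "(\<lambda>n. norm ((-1) ^ n * a n)) \<longlonglongrightarrow> 0"
      using summable_LIMSEQ_zero[OF s1] tendsto_norm_zero by blast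
    moreover have "norm ((-1) ^ n * a n) = a n" for n
      by (simp add: abs_mult power_abs a_def)
    ultimately show ?thesis by simp
  qed
  \<comment> \<open>An even number of terms of a decreasing alternating series bounds its sum from
    below; the sum enters \<open>clifford 1 (- 5)\<close> with a minus sign.\<close>
  then have "(\<Sum>i<2*1. (-1) ^ i * a i) \<le> (\<Sum>i. (-1) ^ i * a i)"
    using summable_Leibniz'(2)[of a 1] dec by (simp add: a_def)
  moreover have "clifford 1 (- 5) = (\<Sum>n. f (n + 3)) + (\<Sum>i<3. f i)"
    using suminf_split_initial_segment[OF sf, of 3] by (simp only: clifford_def f_def[abs_def])
  moreover have "(\<Sum>n. f (n + 3)) = - (\<Sum>i. (-1) ^ i * a i)"
    unfolding fa by (rule suminf_minus[OF s1])
  ultimately have "clifford 1 (- 5) \<le> (\<Sum>i<3. f i) - (\<Sum>i<2. (-1) ^ i * a i)"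
    by simp
  also have "\<dots> < 0"
    by (simp add: f_def a_def eval_nat_numeral lessThan_Suc)
  finally show ?thesis .
qed


section \<open>The first zero of \<open>F0\<close>\<close>

text \<open>The compact zero set attains its infimum, and a nonpositive value further left would
  produce an earlier zero by the intermediate value theorem. This is what makes a
  \<open>LEAST\<close> over the reals an actual first zero, for J_1, J_0 and \<open>F0\<close>
  alike.\<close>

lemma first_zero_decreasing:
  fixes f :: "real \<Rightarrow> real"
  assumes "a \<le> b" "continuous_on {a..b} f" "0 < f a" "f b < 0"
  obtains c where "a < c" "c < b" "f c = 0" "\<And>t. a \<le> t \<Longrightarrow> t < c \<Longrightarrow> 0 < f t"
proof -
  define S where "S = {a..b} \<inter> f -` {0}"
  have "closed S"
    unfolding S_def using assms(2) by (intro continuous_closed_preimage) auto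
  then have "compact S"
    unfolding S_def by (metis Int_lower1 bounded_closed_interval bounded_subset compact_eq_bounded_closed)
  moreover have zero: "\<exists>x. a \<le> x \<and> x \<le> t \<and> f x = 0" if "a \<le> t" "t \<le> b" "f t \<le> 0" for t
    using that assms by (intro IVT2') (auto intro: continuous_on_subset)
  then have "S \<noteq> {}"
    using assms by (fastforce simp: S_def)
  ultimately obtain c where c: "c \<in> S" "\<And>t. t \<in> S \<Longrightarrow> c \<le> t"
    using compact_attains_inf by metis
  have "c \<noteq> a" "c \<noteq> b" using c(1) assms by (auto simp: S_def)
  moreover have "0 < f t" if t: "a \<le> t" "t < c" for t
  proof (rule ccontr)
    assume "\<not> 0 < f t"
    moreover have "t \<le> b" using t c(1) by (auto simp: S_def)
    ultimately obtain x where "a \<le> x" "x \<le> t" "f x = 0"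
      using zero[of t] t(1) by auto
    with t \<open>t \<le> b\<close> c(2)[of x] show False by (auto simp: S_def)
  qed
  ultimately show thesis
    using that[of c] c(1) by (auto simp: S_def)
qed

text \<open>In the variable \<open>t = x^2 / 4\<close> the positive zeros of J_1 are those of
  \<open>clifford 1 (- t)\<close>, because the factor \<open>x / 2\<close> does not vanish; a first
  zero \<open>q\<close> there gives the minimum \<open>2 * sqrt q\<close> that \<open>LEAST\<close>
  asks for.\<close>

lemma bessel_J_root_1_1:
  shows bessel_J_root_1_1_pos: "0 < bessel_J_root 1 1"
    and clifford_1_at_root: "clifford 1 (- ((bessel_J_root 1 1)\<^sup>2 / 4)) = 0"
    and clifford_1_minus_pos: "\<And>t. 0 \<le> t \<Longrightarrow> t < (bessel_J_root 1 1)\<^sup>2 / 4 \<Longrightarrow> 0 < clifford 1 (- t)"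
proof -
  obtain q where q: "0 < q" "clifford 1 (- q) = 0"
      "\<And>t. 0 \<le> t \<Longrightarrow> t < q \<Longrightarrow> 0 < clifford 1 (- t)"
    using clifford_1_minus_5
    by (rule first_zero_decreasing[of 0 5 "\<lambda>t. clifford 1 (- t)", rotated 3])
       (auto intro!: continuous_intros)
  have "bessel_J_root 1 1 = (LEAST x. 0 < x \<and> bessel_J 1 x = 0)"
    by simp
  also have "\<dots> = 2 * sqrt q"
  proof (rule Least_equality)
    show "0 < 2 * sqrt q \<and> bessel_J 1 (2 * sqrt q) = 0"
      using q by (simp add: bessel_J_eq_clifford power_mult_distrib)
    fix x assume x: "0 < x \<and> bessel_J 1 x = 0"
    then have "clifford 1 (- (x\<^sup>2 / 4)) = 0"
      unfolding bessel_J_eq_clifford by (auto simp del: One_nat_def)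
    then have "q \<le> x\<^sup>2 / 4"
      using q(3)[of "x\<^sup>2 / 4"] by force
    then have "sqrt q \<le> sqrt ((x / 2)\<^sup>2)"
      by (intro real_sqrt_le_mono) (simp add: power_divide)
    then show "2 * sqrt q \<le> x" using x by simp
  qed
  finally have eq: "bessel_J_root 1 1 = 2 * sqrt q" .
  have "(bessel_J_root 1 1)\<^sup>2 / 4 = q"
    unfolding eq using q by (simp add: power_mult_distrib)
  with q eq show "0 < bessel_J_root 1 1" "clifford 1 (- ((bessel_J_root 1 1)\<^sup>2 / 4)) = 0"
     "\<And>t. 0 \<le> t \<Longrightarrow> t < (bessel_J_root 1 1)\<^sup>2 / 4 \<Longrightarrow> 0 < clifford 1 (- t)"
    by (simp_all del: bessel_J_root.simps One_nat_def)
qed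

declare bessel_J_root.simps [simp del]

text \<open>The point \<open>p\<close> is \<open>j\<^sub>0\<^sub>,\<^sub>1\<^sup>2 / 4\<close>, so this contains \<open>j\<^sub>0\<^sub>,\<^sub>1 < j\<^sub>1\<^sub>,\<^sub>1\<close>.\<close>

lemma clifford_0_minus_sign_change:
  obtains p where "0 < p" "p < (bessel_J_root 1 1)\<^sup>2 / 4"
    "\<And>t. 0 \<le> t \<Longrightarrow> t \<le> p \<Longrightarrow> 0 \<le> clifford 0 (- t)"
    "\<And>t. p < t \<Longrightarrow> t \<le> (bessel_J_root 1 1)\<^sup>2 / 4 \<Longrightarrow> clifford 0 (- t) < 0"
proof -
  define q where "q = (bessel_J_root 1 1)\<^sup>2 / 4"
  have q: "0 < q" "clifford 1 (- q) = 0" "\<And>t. 0 \<le> t \<Longrightarrow> t < q \<Longrightarrow> 0 < clifford 1 (- t)"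
    using bessel_J_root_1_1 by (auto simp: q_def)
  have D: "((\<lambda>t. clifford 0 (- t)) has_real_derivative - clifford 1 (- t)) (at t)" for t
    by (auto intro!: derivative_eq_intros)
  have dec: "clifford 0 (- t) < clifford 0 (- s)" if "0 \<le> s" "s < t" "t \<le> q" for s t
  proof (rule DERIV_neg_imp_decreasing_open[OF \<open>s < t\<close>])
    show "\<exists>y. ((\<lambda>t. clifford 0 (- t)) has_real_derivative y) (at x) \<and> y < 0" if "s < x" "x < t" for x
      using D[of x] q(3)[of x] that \<open>0 \<le> s\<close> \<open>t \<le> q\<close> by (intro exI conjI) auto
  qed (auto intro!: continuous_intros)
  \<comment> \<open>Otherwise \<open>clifford 0 (- t)\<close>, which decreases up to
    \<open>q\<close>, would be positive before \<open>q\<close>. It is the derivative of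
    \<open>t * clifford 1 (- t)\<close>, which would then increase strictly from 0 to its value 0 at
    \<open>q\<close>.\<close>
  have neg: "clifford 0 (- q) < 0"
  proof (rule ccontr)
    assume "\<not> clifford 0 (- q) < 0"
    then have pos: "0 < clifford 0 (- t)" if "0 \<le> t" "t < q" for t
      using dec[of t q] that by simp
    have "0 ^ Suc 0 * clifford (Suc 0) (- 0) < q ^ Suc 0 * clifford (Suc 0) (- q)"
    proof (rule DERIV_pos_imp_increasing_open[OF \<open>0 < q\<close>])
      show "\<exists>y. ((\<lambda>t. t ^ Suc 0 * clifford (Suc 0) (- t)) has_real_derivative y) (at x) \<and> 0 < y"
        if "0 < x" "x < q" for x
        using DERIV_power_clifford[of 0 x] pos[of x] that by (intro exI conjI) auto
    qed (intro continuous_intros)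
    then show False using q by simp
  qed
  obtain p where p: "0 < p" "p < q" "clifford 0 (- p) = 0"
      "\<And>t. 0 \<le> t \<Longrightarrow> t < p \<Longrightarrow> 0 < clifford 0 (- t)"
    using neg
    by (rule first_zero_decreasing[of 0 q "\<lambda>t. clifford 0 (- t)", rotated 3])
       (use \<open>0 < q\<close> in \<open>auto intro!: continuous_intros\<close>)
  have "0 \<le> clifford 0 (- t)" if "0 \<le> t" "t \<le> p" for t
    using p(3) p(4)[of t] that by (cases "t = p") auto
  moreover have "clifford 0 (- t) < 0" if "p < t" "t \<le> q" for t
    using dec[of p t] p(1,3) that by simp
  ultimately show thesis
    using that[of p] p(1,2) unfolding q_def by blast
qed

text \<open>Induction on the order: for t > 0 the function
  \<open>t ^ (k+2) * clifford (k+2) (- t)\<close> starts at 0 and has the derivative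
  \<open>t ^ (k+1) * clifford (k+1) (- t)\<close>, positive by hypothesis. Hence no J_k with k \<ge>
  1 has a positive zero before \<open>j_{1,1}\<close>.\<close>

lemma clifford_Suc_minus_pos:
  "0 \<le> t \<Longrightarrow> t < (bessel_J_root 1 1)\<^sup>2 / 4 \<Longrightarrow> 0 < clifford (Suc k) (- t)"
proof (induction k arbitrary: t)
  case 0
  then show ?case using clifford_1_minus_pos by simp
next
  case (Suc k)
  show ?case
  proof (cases "t = 0")
    case False
    have "0 ^ Suc (Suc k) * clifford (Suc (Suc k)) (- 0) < t ^ Suc (Suc k) * clifford (Suc (Suc k)) (- t)"
    proof (rule DERIV_pos_imp_increasing_open[of 0 t "\<lambda>t. t ^ Suc (Suc k) * clifford (Suc (Suc k)) (- t)"])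
      show "\<exists>y. ((\<lambda>t. t ^ Suc (Suc k) * clifford (Suc (Suc k)) (- t)) has_real_derivative y) (at x) \<and> 0 < y"
        if "0 < x" "x < t" for x
        using DERIV_power_clifford[of "Suc k" x] Suc.IH[of x] Suc.prems that
        by (intro exI[of _ "x ^ Suc k * clifford (Suc k) (- x)"] conjI mult_pos_pos zero_less_power) auto
    qed (use False Suc.prems in \<open>auto intro!: continuous_intros\<close>)
    moreover have "0 < t ^ Suc (Suc k)"
      using False Suc.prems(1) by (intro zero_less_power) simp
    ultimately show ?thesis
      using zero_less_mult_pos[of "t ^ Suc (Suc k)" "clifford (Suc (Suc k)) (- t)"] by simp
  qed (simp add: clifford_pos)
qed

text \<open>This says \<open>I\<^sub>1 < I\<^sub>0\<close>.\<close>

lemma clifford_1_less_clifford_0: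
  assumes "0 \<le> b"
  shows "b * (clifford 1 b)\<^sup>2 < (clifford 0 b)\<^sup>2"
proof -
  define f where "f b = (clifford 0 b)\<^sup>2 - b * (clifford 1 b)\<^sup>2" for b
  have "f 0 \<le> f b"
  proof (rule DERIV_nonneg_imp_nondecreasing[OF assms])
    fix x :: real
    have "(f has_real_derivative 2 * clifford 0 x * clifford 1 x
        - ((clifford 1 x)\<^sup>2 + x * (2 * clifford 1 x * clifford (Suc 1) x))) (at x)"
      unfolding f_def by (auto intro!: derivative_eq_intros)
    \<comment> \<open>Inserting the recurrence for \<open>clifford 0 x\<close> leaves a perfect
      square.\<close>
    moreover have "2 * clifford 0 x * clifford 1 x
        - ((clifford 1 x)\<^sup>2 + x * (2 * clifford 1 x * clifford (Suc 1) x)) = (clifford 1 x)\<^sup>2"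
      unfolding clifford_rec_0[of x, symmetric] by (simp add: algebra_simps power2_eq_square)
    ultimately show "\<exists>y. (f has_real_derivative y) (at x) \<and> 0 \<le> y"
      by (metis zero_le_power2)
  qed
  moreover have "f 0 = 1" by (simp add: f_def)
  ultimately show ?thesis by (simp add: f_def)
qed

lemma DERIV_mult_clifford_1: "((\<lambda>b. b * clifford 1 b) has_real_derivative clifford 0 b) (at b)"
  using clifford_rec_0[of b] by (auto intro!: derivative_eq_intros simp: algebra_simps)

text \<open>The quotient is half of \<open>x I_0'(x) / I_0(x)\<close> at
  \<open>x = 2 * sqrt b\<close>. The numerator of its derivative is
  \<open>(clifford 0 x)^2 - x * (clifford 1 x)^2\<close>, positive because I_1 < I_0. For fixed
  \<alpha> it carries the dependence of \<open>F0\<close> on \<kappa>.\<close>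

lemma mult_clifford_ratio_strict_mono:
  assumes "0 \<le> a" "a < b"
  shows "a * clifford 1 a / clifford 0 a < b * clifford 1 b / clifford 0 b"
proof (rule DERIV_pos_imp_increasing_open[OF \<open>a < b\<close>])
  fix x assume "a < x" "x < b"
  then have x: "0 \<le> x" using assms by simp
  then have nz: "0 < clifford 0 x" by (rule clifford_pos)
  have "((\<lambda>b. b * clifford 1 b / clifford 0 b) has_real_derivative
      (clifford 0 x * clifford 0 x - (x * clifford 1 x) * clifford (Suc 0) x) / (clifford 0 x * clifford 0 x))
      (at x)"
    using nz by (intro DERIV_divide DERIV_mult_clifford_1 DERIV_clifford) auto
  moreover have "0 < (clifford 0 x * clifford 0 x - (x * clifford 1 x) * clifford (Suc 0) x) / (clifford 0 x * clifford 0 x)"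
    using clifford_1_less_clifford_0[OF x] nz
    by (intro divide_pos_pos mult_pos_pos) (auto simp: power2_eq_square algebra_simps)
  ultimately show "\<exists>y. ((\<lambda>b. b * clifford 1 b / clifford 0 b) has_real_derivative y) (at x) \<and> 0 < y"
    by blast
next
  show "continuous_on {a..b} (\<lambda>b. b * clifford 1 b / clifford 0 b)"
    using assms by (intro continuous_intros) (metis atLeastAtMost_iff clifford_pos less_irrefl order_trans)
qed

text \<open>The minus sign in the derivative of J_0 cancels the one in \<open>F0\<close>, so the
  sign of each summand can be read off from J_0 and J_1 alone.\<close>

lemma F0_eq_clifford:
  fixes \<kappa> \<alpha> :: real
  defines "a \<equiv> \<alpha>\<^sup>2 / 4" and "b \<equiv> (\<kappa> / \<alpha>)\<^sup>2 / 4"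
  shows "F0 \<kappa> \<alpha> = 2 * (b * clifford 0 (- a) * clifford 1 b + a * clifford 0 b * clifford 1 (- a))"
  unfolding F0_def deriv_bessel_J_0 deriv_bessel_I_0 bessel_J_eq_clifford bessel_I_eq_clifford a_def b_def
  by (simp add: algebra_simps power2_eq_square)

text \<open>Up to \<open>s\<close>, which is \<open>j_{0,1}\<close>, the first summand of
  \<open>F0_eq_clifford\<close> is nonnegative and the second positive. At \<open>j_{1,1}\<close>
  the second vanishes and the first has the negative sign of J_0. The first zero therefore lies
  strictly between, where J_0 < 0.\<close>

lemma alpha01:
  assumes "0 < \<kappa>"
  shows alpha01_pos: "0 < alpha01 \<kappa>"
    and F0_alpha01: "F0 \<kappa> (alpha01 \<kappa>) = 0"
    and alpha01_less: "alpha01 \<kappa> < bessel_J_root 1 1"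
    and clifford_0_alpha01: "clifford 0 (- ((alpha01 \<kappa>)\<^sup>2 / 4)) < 0"
    and F0_pos: "\<And>\<alpha>. 0 < \<alpha> \<Longrightarrow> \<alpha> < alpha01 \<kappa> \<Longrightarrow> 0 < F0 \<kappa> \<alpha>"
proof -
  let ?j = "bessel_J_root 1 1"
  have j: "0 < ?j" by (rule bessel_J_root_1_1_pos)
  obtain p where p: "0 < p" "p < ?j\<^sup>2 / 4"
    and c0: "\<And>t. 0 \<le> t \<Longrightarrow> t \<le> p \<Longrightarrow> 0 \<le> clifford 0 (- t)"
    and c0_neg: "\<And>t. p < t \<Longrightarrow> t \<le> ?j\<^sup>2 / 4 \<Longrightarrow> clifford 0 (- t) < 0"
    by (rule clifford_0_minus_sign_change) (rule that)
  define s where "s = 2 * sqrt p"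
  have s: "0 < s" "s\<^sup>2 / 4 = p" using p by (simp_all add: s_def power_mult_distrib)
  have "s\<^sup>2 < ?j\<^sup>2" using s p by simp
  then have "s < ?j" using j by (rule power2_less_imp_less[OF _ less_imp_le])
  have small: "0 < F0 \<kappa> \<alpha>" if "0 < \<alpha>" "\<alpha> \<le> s" for \<alpha>
  proof -
    have "\<alpha>\<^sup>2 \<le> s\<^sup>2" using that by (intro power_mono) auto
    then have \<alpha>: "\<alpha>\<^sup>2 / 4 \<le> p" using s by simp
    have "0 < clifford 1 (- (\<alpha>\<^sup>2 / 4))"
      using \<alpha> p by (intro clifford_1_minus_pos) auto
    moreover have "0 \<le> clifford 0 (- (\<alpha>\<^sup>2 / 4))"
      using \<alpha> by (intro c0) auto
    moreover have "0 < clifford k ((\<kappa> / \<alpha>)\<^sup>2 / 4)" for k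
      by (intro clifford_pos) auto
    ultimately show ?thesis
      unfolding F0_eq_clifford using that
      by (intro mult_pos_pos add_nonneg_pos mult_nonneg_nonneg) (auto intro: less_imp_le)
  qed
  have "0 < (\<kappa> / ?j)\<^sup>2 / 4" using assms j by simp
  moreover have "clifford 0 (- (?j\<^sup>2 / 4)) < 0" using p by (intro c0_neg) auto
  moreover have "0 < clifford 1 ((\<kappa> / ?j)\<^sup>2 / 4)" by (intro clifford_pos) auto
  ultimately have large: "F0 \<kappa> ?j < 0"
    unfolding F0_eq_clifford clifford_1_at_root by (simp add: mult_neg_pos mult_pos_neg)
  have cont: "continuous_on {s..?j} (F0 \<kappa>)"
    unfolding F0_eq_clifford[abs_def] using s by (auto intro!: continuous_intros)
  obtain r where r: "s < r" "r < ?j" "F0 \<kappa> r = 0"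
      "\<And>t. s \<le> t \<Longrightarrow> t < r \<Longrightarrow> 0 < F0 \<kappa> t"
    by (rule first_zero_decreasing[OF less_imp_le[OF \<open>s < ?j\<close>] cont small[OF s(1) order_refl] large])
       (rule that)
  have pos: "0 < F0 \<kappa> \<alpha>" if "0 < \<alpha>" "\<alpha> < r" for \<alpha>
    using small[of \<alpha>] r(4)[of \<alpha>] that by linarith
  have eq: "alpha01 \<kappa> = r"
    unfolding alpha01_def
    by (rule Least_equality) (use s r(1,3) pos in force)+
  have "s\<^sup>2 < r\<^sup>2" "r\<^sup>2 < ?j\<^sup>2"
    by (rule power_strict_mono; use r(1,2) s(1) in simp)+
  then have "clifford 0 (- (r\<^sup>2 / 4)) < 0"
    using s by (intro c0_neg) auto
  then show "0 < alpha01 \<kappa>" "F0 \<kappa> (alpha01 \<kappa>) = 0" "alpha01 \<kappa> < ?j"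
    "clifford 0 (- ((alpha01 \<kappa>)\<^sup>2 / 4)) < 0"
    "\<And>\<alpha>. 0 < \<alpha> \<Longrightarrow> \<alpha> < alpha01 \<kappa> \<Longrightarrow> 0 < F0 \<kappa> \<alpha>"
    using r s pos by (auto simp: eq)
qed

section \<open>Dependence of the first zero and of the eigenvalue on \<kappa>\<close>

lemma alpha01_strict_antimono:
  assumes "0 < \<kappa>\<^sub>1" "\<kappa>\<^sub>1 < \<kappa>\<^sub>2"
  shows "alpha01 \<kappa>\<^sub>2 < alpha01 \<kappa>\<^sub>1"
proof (rule ccontr)
  define \<alpha> where "\<alpha> = alpha01 \<kappa>\<^sub>1"
  define a where "a = \<alpha>\<^sup>2 / 4"
  define b\<^sub>1 where "b\<^sub>1 = (\<kappa>\<^sub>1 / \<alpha>)\<^sup>2 / 4"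
  define b\<^sub>2 where "b\<^sub>2 = (\<kappa>\<^sub>2 / \<alpha>)\<^sup>2 / 4"
  have \<alpha>: "0 < \<alpha>" using alpha01_pos assms by (simp add: \<alpha>_def)
  have neg: "clifford 0 (- a) < 0"
    using clifford_0_alpha01[OF assms(1)] by (simp add: a_def \<alpha>_def)
  have "0 \<le> b\<^sub>1" by (simp add: b\<^sub>1_def)
  have "b\<^sub>1 < b\<^sub>2" unfolding b\<^sub>1_def b\<^sub>2_def
    using assms \<alpha> by (intro divide_strict_right_mono power_strict_mono) (auto intro: divide_nonneg_pos)
  have p1: "0 < clifford 0 b\<^sub>1" and p2: "0 < clifford 0 b\<^sub>2"
    using \<open>0 \<le> b\<^sub>1\<close> \<open>b\<^sub>1 < b\<^sub>2\<close> by (auto intro!: clifford_pos)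
  have "F0 \<kappa>\<^sub>1 \<alpha> = 0" using F0_alpha01 assms by (simp add: \<alpha>_def)
  \<comment> \<open>Dividing by \<open>clifford 0 b\<^sub>1 > 0\<close> moves \<kappa> entirely into
    the increasing ratio; its factor \<open>clifford 0 (- a)\<close> is negative, so a larger
    \<kappa> lowers the left side.\<close>
  then have "b\<^sub>1 * clifford 1 b\<^sub>1 / clifford 0 b\<^sub>1 * clifford 0 (- a) = - a * clifford 1 (- a)"
    using p1 unfolding F0_eq_clifford a_def[symmetric] b\<^sub>1_def[symmetric] by (simp add: field_simps)
  moreover have "b\<^sub>2 * clifford 1 b\<^sub>2 / clifford 0 b\<^sub>2 * clifford 0 (- a)
      < b\<^sub>1 * clifford 1 b\<^sub>1 / clifford 0 b\<^sub>1 * clifford 0 (- a)"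
    using mult_clifford_ratio_strict_mono[OF \<open>0 \<le> b\<^sub>1\<close> \<open>b\<^sub>1 < b\<^sub>2\<close>] neg
    by (intro mult_strict_right_mono_neg)
  ultimately have "b\<^sub>2 * clifford 1 b\<^sub>2 / clifford 0 b\<^sub>2 * clifford 0 (- a) + a * clifford 1 (- a) < 0"
    by simp
  then have "clifford 0 b\<^sub>2 * (b\<^sub>2 * clifford 1 b\<^sub>2 / clifford 0 b\<^sub>2 * clifford 0 (- a) + a * clifford 1 (- a)) < 0"
    using p2 by (simp only: mult_less_0_iff) simp
  then have "F0 \<kappa>\<^sub>2 \<alpha> < 0"
    using p2 unfolding F0_eq_clifford a_def[symmetric] b\<^sub>2_def[symmetric] by (simp add: algebra_simps)
  \<comment> \<open>\<open>F0 \<kappa>\<^sub>2\<close> is positive before its first zero and zero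
    there, so a negative value at \<alpha> puts that zero strictly before \<alpha>.\<close>
  moreover assume "\<not> alpha01 \<kappa>\<^sub>2 < alpha01 \<kappa>\<^sub>1"
  ultimately show False
    using F0_alpha01[of \<kappa>\<^sub>2] F0_pos[of \<kappa>\<^sub>2] \<alpha> assms unfolding \<alpha>_def[symmetric] by force
qed

lemma strict_antimono_eigenvalue:
  "strict_antimono_on {0<..} (\<lambda>\<kappa>. (alpha01 \<kappa>)\<^sup>2 - \<kappa>\<^sup>2 / (alpha01 \<kappa>)\<^sup>2)"
proof (rule monotone_onI)
  fix \<kappa>\<^sub>1 \<kappa>\<^sub>2 :: real assume "\<kappa>\<^sub>1 \<in> {0<..}" "\<kappa>\<^sub>2 \<in> {0<..}" "\<kappa>\<^sub>1 < \<kappa>\<^sub>2"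
  then have k: "0 < \<kappa>\<^sub>1" "0 < \<kappa>\<^sub>2" by auto
  have 0: "0 < alpha01 \<kappa>\<^sub>2" using alpha01_pos k by simp
  have 1: "(alpha01 \<kappa>\<^sub>2)\<^sup>2 < (alpha01 \<kappa>\<^sub>1)\<^sup>2"
    using alpha01_strict_antimono[of \<kappa>\<^sub>1 \<kappa>\<^sub>2] \<open>\<kappa>\<^sub>1 < \<kappa>\<^sub>2\<close> k 0 by (intro power_strict_mono) auto
  have "\<kappa>\<^sub>1\<^sup>2 / (alpha01 \<kappa>\<^sub>1)\<^sup>2 \<le> \<kappa>\<^sub>2\<^sup>2 / (alpha01 \<kappa>\<^sub>2)\<^sup>2"
    using 0 1 k \<open>\<kappa>\<^sub>1 < \<kappa>\<^sub>2\<close> by (intro frac_le less_imp_le[OF 1] power_mono) auto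
  with 1 show "(alpha01 \<kappa>\<^sub>1)\<^sup>2 - \<kappa>\<^sub>1\<^sup>2 / (alpha01 \<kappa>\<^sub>1)\<^sup>2 > (alpha01 \<kappa>\<^sub>2)\<^sup>2 - \<kappa>\<^sub>2\<^sup>2 / (alpha01 \<kappa>\<^sub>2)\<^sup>2"
    by simp
qed

lemma filterlim_eigenvalue_at_top:
  "filterlim (\<lambda>\<kappa>. (alpha01 \<kappa>)\<^sup>2 - \<kappa>\<^sup>2 / (alpha01 \<kappa>)\<^sup>2) at_bot at_top"
proof (rule filterlim_at_bot_mono)
  let ?j = "bessel_J_root 1 1"
  have j: "0 < ?j" by (rule bessel_J_root_1_1_pos)
  then have "filterlim (\<lambda>\<kappa>::real. 1 / ?j\<^sup>2 * \<kappa>\<^sup>2) at_top at_top"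
    by (intro filterlim_tendsto_pos_mult_at_top[OF tendsto_const] filterlim_pow_at_top filterlim_ident) auto
  then have "filterlim (\<lambda>\<kappa>::real. - ?j\<^sup>2 + 1 / ?j\<^sup>2 * \<kappa>\<^sup>2) at_top at_top"
    by (rule filterlim_tendsto_add_at_top[OF tendsto_const])
  \<comment> \<open>The majorant replaces \<open>alpha01 \<kappa>\<close> by its upper bound
    \<open>j_{1,1}\<close> in both terms of the eigenvalue.\<close>
  then show "filterlim (\<lambda>\<kappa>::real. - (- ?j\<^sup>2 + 1 / ?j\<^sup>2 * \<kappa>\<^sup>2)) at_bot at_top"
    by (simp only: filterlim_uminus_at_bot minus_minus)
  have "\<forall>\<^sub>F \<kappa> in at_top. (0::real) < \<kappa>" by (rule eventually_gt_at_top)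
  then show "\<forall>\<^sub>F \<kappa> in at_top. (alpha01 \<kappa>)\<^sup>2 - \<kappa>\<^sup>2 / (alpha01 \<kappa>)\<^sup>2 \<le> - (- ?j\<^sup>2 + 1 / ?j\<^sup>2 * \<kappa>\<^sup>2)"
  proof eventually_elim
    case (elim \<kappa>)
    note a = alpha01_pos[OF elim] alpha01_less[OF elim]
    then have "(alpha01 \<kappa>)\<^sup>2 \<le> ?j\<^sup>2" by (intro power_mono) auto
    moreover from this have "\<kappa>\<^sup>2 / ?j\<^sup>2 \<le> \<kappa>\<^sup>2 / (alpha01 \<kappa>)\<^sup>2"
      using a by (intro divide_left_mono) auto
    ultimately show ?case by simp
  qed
qed

text \<open>The limit \<open>L\<close> of \<open>alpha01\<close> exists by monotonicity, and passing to the limit in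
  \<open>F0 \<kappa> (alpha01 \<kappa>) = 0\<close> makes \<open>L\<close> a zero of \<open>J\<^sub>1\<close>.\<close>

lemma tendsto_alpha01_at_right_0: "(alpha01 \<longlongrightarrow> bessel_J_root 1 1) (at_right 0)"
proof -
  let ?j = "bessel_J_root 1 1"
  define L where "L = Sup (alpha01 ` {0<..})"
  have pos: "\<forall>\<^sub>F \<kappa> in at_right 0. (0::real) < \<kappa>" by (rule eventually_at_right_less)
  have bdd: "bdd_above (alpha01 ` {0<..})"
    using alpha01_less by (intro bdd_aboveI[of _ ?j]) (auto intro: less_imp_le)
  have le: "alpha01 \<kappa> \<le> L" if "0 < \<kappa>" for \<kappa>
    unfolding L_def using that by (intro cSup_upper bdd) auto
  have "L \<le> ?j"
    unfolding L_def using alpha01_less by (intro cSup_least) (auto intro: less_imp_le)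
  have "0 < L" using le[of 1] alpha01_pos[of 1] by simp
  have lim: "(alpha01 \<longlongrightarrow> L) (at_right 0)"
  proof (rule order_tendstoI)
    fix a assume "L < a"
    from pos show "\<forall>\<^sub>F \<kappa> in at_right 0. alpha01 \<kappa> < a"
      by eventually_elim (use le \<open>L < a\<close> in \<open>meson le_less_trans\<close>)
  next
    fix a assume "a < L"
    then obtain \<kappa>\<^sub>0 where k0: "0 < \<kappa>\<^sub>0" "a < alpha01 \<kappa>\<^sub>0"
      unfolding L_def using less_cSup_iff[OF _ bdd, of a] by auto
    have "\<forall>\<^sub>F \<kappa> in at_right 0. \<kappa> < \<kappa>\<^sub>0"
      using k0(1) eventually_at_right by blast
    with pos show "\<forall>\<^sub>F \<kappa> in at_right 0. a < alpha01 \<kappa>"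
      by eventually_elim (use alpha01_strict_antimono k0 in \<open>meson less_trans\<close>)
  qed
  have "((\<lambda>\<kappa>. F0 \<kappa> (alpha01 \<kappa>)) \<longlongrightarrow> F0 0 L) (at_right 0)"
    unfolding F0_eq_clifford using \<open>0 < L\<close> lim by (intro tendsto_intros) auto
  moreover have "((\<lambda>\<kappa>. F0 \<kappa> (alpha01 \<kappa>)) \<longlongrightarrow> 0) (at_right 0)"
    using pos by (intro tendsto_eventually) (auto elim!: eventually_mono simp: F0_alpha01)
  ultimately have "F0 0 L = 0"
    using tendsto_unique trivial_limit_at_right_real by blast
  \<comment> \<open>At \<kappa> = 0 only the summand with \<open>clifford 1 (- a)\<close> of
    \<open>F0\<close> survives. Its other factors are nonzero, so J_1 vanishes at \<open>L\<close>,
    which then cannot lie before \<open>j_{1,1}\<close>.\<close>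
  then have "clifford 1 (- (L\<^sup>2 / 4)) = 0"
    unfolding F0_eq_clifford using \<open>0 < L\<close> by simp
  then have "\<not> L\<^sup>2 / 4 < ?j\<^sup>2 / 4"
    using clifford_1_minus_pos[of "L\<^sup>2 / 4"] by auto
  then have "\<not> L < ?j"
    using power_strict_mono[of L ?j 2] \<open>0 < L\<close> by auto
  with \<open>L \<le> ?j\<close> lim show ?thesis by simp
qed

lemma tendsto_eigenvalue_at_right_0:
  "((\<lambda>\<kappa>. (alpha01 \<kappa>)\<^sup>2 - \<kappa>\<^sup>2 / (alpha01 \<kappa>)\<^sup>2) \<longlongrightarrow> (bessel_J_root 1 1)\<^sup>2) (at_right 0)"
proof -
  have "((\<lambda>\<kappa>. (alpha01 \<kappa>)\<^sup>2 - \<kappa>\<^sup>2 / (alpha01 \<kappa>)\<^sup>2) \<longlongrightarrow>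
      (bessel_J_root 1 1)\<^sup>2 - 0\<^sup>2 / (bessel_J_root 1 1)\<^sup>2) (at_right 0)"
    using bessel_J_root_1_1_pos by (intro tendsto_intros tendsto_alpha01_at_right_0) auto
  then show ?thesis by simp
qed


section \<open>Functions of class \<open>C\<^sup>k\<close>\<close>

lemma partial_deriv_eqI:
  "(f has_derivative D) (at x) \<Longrightarrow> partial_deriv i f x = D (axis i 1)"
  unfolding partial_deriv_def by (drule frechet_derivative_at) simp

lemma partial_deriv_cong:
  assumes "open S" "x \<in> S" "\<And>y. y \<in> S \<Longrightarrow> f y = g y"
  shows "partial_deriv i f x = partial_deriv i g x"
proof -
  have "(f has_derivative D) (at x) \<longleftrightarrow> (g has_derivative D) (at x)" for D
    using has_derivative_transform_within_open[of f D x UNIV S g]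
      has_derivative_transform_within_open[of g D x UNIV S f] assms by auto
  then show ?thesis
    by (simp add: partial_deriv_def frechet_derivative_def)
qed

lemma laplacian_cong:
  assumes "open S" "x \<in> S" "\<And>y. y \<in> S \<Longrightarrow> f y = g y"
  shows "laplacian f x = laplacian g x"
  unfolding laplacian_def
  by (intro sum.cong refl partial_deriv_cong[OF assms(1)] assms)

lemma Ck_on_cong:
  assumes "open S" "\<And>x. x \<in> S \<Longrightarrow> f x = g x"
  shows "Ck_on k f S \<longleftrightarrow> Ck_on k g S"
  using assms(2)
proof (induction k arbitrary: f g)
  case 0
  then show ?case by (simp cong: continuous_on_cong)
next
  case (Suc k)
  have "f differentiable (at x) \<longleftrightarrow> g differentiable (at x)" if "x \<in> S" for x
    unfolding differentiable_def
    using has_derivative_transform_within_open[of f _ x UNIV S g]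
      has_derivative_transform_within_open[of g _ x UNIV S f] assms(1) Suc.prems that by metis
  moreover have "Ck_on k (partial_deriv i f) S \<longleftrightarrow> Ck_on k (partial_deriv i g) S" for i
    by (rule Suc.IH) (rule partial_deriv_cong[OF assms(1) _ Suc.prems])
  ultimately show ?case by auto
qed

lemma Ck_on_SucD: "Ck_on (Suc k) f S \<Longrightarrow> Ck_on k f S"
proof (induction k arbitrary: f)
  case 0
  then show ?case
    by (auto intro!: continuous_at_imp_continuous_on differentiable_imp_continuous_within)
next
  case (Suc k)
  then show ?case by (metis Ck_on.simps(2))
qed

lemma Ck_on_le: "Ck_on n f S \<Longrightarrow> m \<le> n \<Longrightarrow> Ck_on m f S"
  by (induction n) (auto simp: le_Suc_eq dest: Ck_on_SucD simp del: Ck_on.simps(2))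

lemma Ck_on_imp_continuous_on: "Ck_on k f S \<Longrightarrow> continuous_on S f"
  using Ck_on_le[of k f S 0] by simp

lemma has_derivative_partial_deriv:
  fixes f :: "real ^ 'n \<Rightarrow> real"
  assumes "f differentiable (at x)"
  shows "(f has_derivative (\<lambda>h. \<Sum>i\<in>UNIV. h $ i * partial_deriv i f x)) (at x)"
proof -
  let ?D = "frechet_derivative f (at x)"
  have D: "(f has_derivative ?D) (at x)"
    using assms frechet_derivative_works by blast
  then interpret bounded_linear ?D by (rule has_derivative_bounded_linear)
  have "?D h = (\<Sum>i\<in>UNIV. h $ i * partial_deriv i f x)" for h
  proof -
    have "?D h = ?D (\<Sum>i\<in>UNIV. h $ i *\<^sub>R axis i 1)"
      using basis_expansion[of h] by (simp add: scalar_mult_eq_scaleR)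
    then show ?thesis by (simp add: sum scaleR partial_deriv_def)
  qed
  then have "?D = (\<lambda>h. \<Sum>i\<in>UNIV. h $ i * partial_deriv i f x)" by blast
  with D show ?thesis by simp
qed

lemma partial_deriv_add:
  assumes "f differentiable (at x)" "g differentiable (at x)"
  shows "partial_deriv i (\<lambda>x. f x + g x) x = partial_deriv i f x + partial_deriv i g x"
  using partial_deriv_eqI[OF has_derivative_add[OF assms[unfolded frechet_derivative_works]]]
  by (simp add: partial_deriv_def)

lemma partial_deriv_cmult:
  assumes "f differentiable (at x)"
  shows "partial_deriv i (\<lambda>x. c * f x) x = c * partial_deriv i f x"
  using partial_deriv_eqI[OF has_derivative_mult_right[OF assms[unfolded frechet_derivative_works]]]
  by (simp add: partial_deriv_def)

lemma partial_deriv_mult: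
  assumes "f differentiable (at x)" "g differentiable (at x)"
  shows "partial_deriv i (\<lambda>x. f x * g x) x = f x * partial_deriv i g x + partial_deriv i f x * g x"
  using partial_deriv_eqI[OF has_derivative_mult[OF assms[unfolded frechet_derivative_works]]]
  by (simp add: partial_deriv_def)

lemma Ck_on_const: "Ck_on k (\<lambda>x :: real ^ 'n. c) S"
proof (induction k arbitrary: c)
  case (Suc k)
  have "partial_deriv i (\<lambda>x. c) = (\<lambda>x. 0)" for i :: 'n
    by (intro ext) (simp add: partial_deriv_eqI[OF has_derivative_const])
  with Suc show ?case by simp
qed simp

lemma Ck_on_add:
  assumes "open S"
  shows "Ck_on k f S \<Longrightarrow> Ck_on k g S \<Longrightarrow> Ck_on k (\<lambda>x. f x + g x) S"
proof (induction k arbitrary: f g)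
  case (Suc k)
  have "Ck_on k (partial_deriv i (\<lambda>x. f x + g x)) S" for i
    using Suc.prems Suc.IH[of "partial_deriv i f" "partial_deriv i g"]
    by (subst Ck_on_cong[OF assms partial_deriv_add]) auto
  with Suc.prems show ?case by auto
qed (auto intro: continuous_intros)

lemma Ck_on_mult:
  assumes "open S"
  shows "Ck_on k f S \<Longrightarrow> Ck_on k g S \<Longrightarrow> Ck_on k (\<lambda>x. f x * g x) S"
proof (induction k arbitrary: f g)
  case (Suc k)
  note 1 = Suc.prems[THEN Ck_on_SucD]
  have "Ck_on k (\<lambda>x. f x * partial_deriv i g x + partial_deriv i f x * g x) S" for i
    using Suc.prems by (intro Ck_on_add[OF assms] Suc.IH 1) auto
  then have "Ck_on k (partial_deriv i (\<lambda>x. f x * g x)) S" for i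
    using Suc.prems by (subst Ck_on_cong[OF assms partial_deriv_mult]) auto
  with Suc.prems show ?case by auto
qed (auto intro: continuous_intros)

lemma Ck_on_cmult: "open S \<Longrightarrow> Ck_on k f S \<Longrightarrow> Ck_on k (\<lambda>x. c * f x) S"
  by (intro Ck_on_mult Ck_on_const)

lemma Ck_on_sum:
  "open S \<Longrightarrow> (\<And>i. i \<in> I \<Longrightarrow> Ck_on k (f i) S) \<Longrightarrow> Ck_on k (\<lambda>x. \<Sum>i\<in>I. f i x) S"
  by (induction I rule: infinite_finite_induct) (auto intro: Ck_on_const Ck_on_add)

lemma Ck_on_component: "Ck_on k (\<lambda>x :: real ^ 'n. x $ i) S"
proof (cases k)
  case (Suc m)
  have D: "((\<lambda>x :: real ^ 'n. x $ i) has_derivative (\<lambda>h. h $ i)) (at x)" for x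
    by (rule bounded_linear_imp_has_derivative[OF bounded_linear_vec_nth])
  then have "partial_deriv j (\<lambda>x. x $ i) = (\<lambda>x. axis j 1 $ i)" for j :: 'n
    by (intro ext partial_deriv_eqI)
  with D Suc show ?thesis by (auto intro: Ck_on_const differentiableI)
qed (auto intro: continuous_intros)

lemma Ck_on_laplacian:
  assumes "open S" "Ck_on (Suc (Suc k)) f S"
  shows "Ck_on k (laplacian f) S"
  unfolding laplacian_def[abs_def] using assms by (intro Ck_on_sum) auto

lemma laplacian_add:
  assumes "open S" "x \<in> S" "Ck_on 2 f S" "Ck_on 2 g S"
  shows "laplacian (\<lambda>x. f x + g x) x = laplacian f x + laplacian g x"
proof -
  have "partial_deriv i (partial_deriv i (\<lambda>x. f x + g x)) x
      = partial_deriv i (partial_deriv i f) x + partial_deriv i (partial_deriv i g) x" for i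
  proof -
    have "partial_deriv i (partial_deriv i (\<lambda>x. f x + g x)) x
        = partial_deriv i (\<lambda>x. partial_deriv i f x + partial_deriv i g x) x"
      using assms by (intro partial_deriv_cong[OF assms(1,2)] partial_deriv_add) (auto simp: numeral_2_eq_2)
    then show ?thesis
      using assms by (simp add: partial_deriv_add numeral_2_eq_2)
  qed
  then show ?thesis by (simp add: laplacian_def sum.distrib)
qed

lemma laplacian_cmult:
  assumes "open S" "x \<in> S" "Ck_on 2 f S"
  shows "laplacian (\<lambda>x. c * f x) x = c * laplacian f x"
proof -
  have "partial_deriv i (partial_deriv i (\<lambda>x. c * f x)) x = c * partial_deriv i (partial_deriv i f) x" for i
  proof -
    have "partial_deriv i (partial_deriv i (\<lambda>x. c * f x)) x
        = partial_deriv i (\<lambda>x. c * partial_deriv i f x) x"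
      using assms by (intro partial_deriv_cong[OF assms(1,2)] partial_deriv_cmult) (auto simp: numeral_2_eq_2)
    then show ?thesis
      using assms by (simp add: partial_deriv_cmult numeral_2_eq_2)
  qed
  then show ?thesis by (simp add: laplacian_def sum_distrib_left)
qed

lemma laplacian_lincomb:
  assumes "open S" "x \<in> S" "Ck_on 2 f S" "Ck_on 2 g S"
  shows "laplacian (\<lambda>x. a * f x + b * g x) x = a * laplacian f x + b * laplacian g x"
  using assms by (simp add: laplacian_add laplacian_cmult Ck_on_cmult)

section \<open>Radial functions on the plane and their Laplacian\<close>

lemma has_derivative_clifford_norm:
  "((\<lambda>x::real ^ 'n. clifford k (s * (norm x)\<^sup>2 / 4)) has_derivative
     (\<lambda>h. clifford (Suc k) (s * (norm x)\<^sup>2 / 4) * (s / 2 * (x \<bullet> h)))) (at x)"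
proof -
  have "((\<lambda>x::real ^ 'n. s * (norm x)\<^sup>2 / 4) has_derivative (\<lambda>h. s / 2 * (x \<bullet> h))) (at x)"
    unfolding power2_norm_eq_inner
    by (auto intro!: derivative_eq_intros simp: inner_commute)
  from has_derivative_compose[OF this DERIV_clifford[THEN has_field_derivative_imp_has_derivative]]
  show ?thesis .
qed

lemma partial_deriv_clifford_norm:
  "partial_deriv i (\<lambda>x::real ^ 'n. clifford k (s * (norm x)\<^sup>2 / 4))
     = (\<lambda>x. s / 2 * (x $ i * clifford (Suc k) (s * (norm x)\<^sup>2 / 4)))"
  by (rule ext) (simp add: partial_deriv_eqI[OF has_derivative_clifford_norm] inner_axis)

text \<open>A partial derivative is a coordinate times a function of the same kind with the next
  index, so the induction must range over all \<open>k\<close>. Using the squared norm keeps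
  everything smooth at the origin.\<close>

lemma Ck_on_clifford_norm:
  assumes "open S"
  shows "Ck_on n (\<lambda>x::real ^ 'n. clifford k (s * (norm x)\<^sup>2 / 4)) S"
proof (induction n arbitrary: k)
  case (Suc n)
  have "Ck_on n (partial_deriv i (\<lambda>x::real ^ 'n. clifford k (s * (norm x)\<^sup>2 / 4))) S" for i
    unfolding partial_deriv_clifford_norm
    by (intro Ck_on_cmult Ck_on_mult Ck_on_component Suc assms)
  then show ?case
    using has_derivative_clifford_norm differentiableI by fastforce
qed (auto intro!: continuous_intros)

text \<open>Each of the two coordinates contributes \<open>s / 2 * clifford 1\<close>, which is
  exactly the weight that the recurrence for index 0 requires; so this is tied to dimension 2. The
  values \<open>s = - \<alpha>^2\<close> and \<open>s = \<beta>^2\<close> give J_0(\<alpha>|x|) and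
  I_0(\<beta>|x|).\<close>

lemma laplacian_clifford_norm:
  "laplacian (\<lambda>x::real ^ 2. clifford 0 (s * (norm x)\<^sup>2 / 4)) x = s * clifford 0 (s * (norm x)\<^sup>2 / 4)"
proof -
  let ?C = "\<lambda>k. clifford k (s * (norm x)\<^sup>2 / 4)"
  have "partial_deriv i (\<lambda>x::real ^ 2. s / 2 * (x $ i * clifford 1 (s * (norm x)\<^sup>2 / 4))) x
      = s / 2 * ?C 1 + s / 2 * (s / 2 * (x $ i)\<^sup>2 * ?C (Suc 1))" for i
  proof -
    have diff: "(\<lambda>x::real ^ 2. x $ i) differentiable at x"
      "(\<lambda>x::real ^ 2. clifford 1 (s * (norm x)\<^sup>2 / 4)) differentiable at x"
      using Ck_on_component[of 1 i UNIV] Ck_on_clifford_norm[of UNIV 1 1 s] by auto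
    have "partial_deriv i (\<lambda>x :: real ^ 2. x $ i) x = 1"
      using partial_deriv_eqI[OF bounded_linear_imp_has_derivative[OF bounded_linear_vec_nth], of i i x]
      by (simp add: axis_def)
    moreover have "partial_deriv i (\<lambda>x::real ^ 2. s / 2 * (x $ i * clifford 1 (s * (norm x)\<^sup>2 / 4))) x
      = s / 2 * (x $ i * partial_deriv i (\<lambda>x::real ^ 2. clifford 1 (s * (norm x)\<^sup>2 / 4)) x
                 + partial_deriv i (\<lambda>x :: real ^ 2. x $ i) x * ?C 1)"
      by (subst partial_deriv_cmult[OF differentiable_mult[OF diff]], subst partial_deriv_mult[OF diff]) simp
    ultimately show ?thesis
      unfolding partial_deriv_clifford_norm by (simp add: field_simps power2_eq_square)
  qed
  then have "laplacian (\<lambda>x::real ^ 2. clifford 0 (s * (norm x)\<^sup>2 / 4)) x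
      = s * ?C 1 + s * (s * ((x $ 1)\<^sup>2 + (x $ 2)\<^sup>2) / 4 * ?C (Suc 1))"
    by (simp add: laplacian_def partial_deriv_clifford_norm sum_2 algebra_simps)
  also have "(x $ 1)\<^sup>2 + (x $ 2)\<^sup>2 = (norm x)\<^sup>2"
    unfolding power2_norm_eq_inner by (simp add: inner_vec_def sum_2 power2_eq_square)
  finally show ?thesis
    unfolding clifford_rec_0[of "s * (norm x)\<^sup>2 / 4", symmetric] by (simp add: algebra_simps)
qed


section \<open>Angular Fourier coefficients\<close>

definition circle_pt :: "real \<Rightarrow> real ^ 2" where
  "circle_pt \<theta> = vector [cos \<theta>, sin \<theta>]"

lemma circle_pt_nth [simp]: "circle_pt \<theta> $ 1 = cos \<theta>" "circle_pt \<theta> $ 2 = sin \<theta>"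
  by (simp_all add: circle_pt_def)

lemma norm_circle_pt [simp]: "norm (circle_pt \<theta>) = 1"
  by (simp add: norm_eq_sqrt_inner inner_vec_def sum_2 flip: power2_eq_square)

lemma circle_pt_exhaust:
  obtains r \<theta> where "0 \<le> r" "0 \<le> \<theta>" "\<theta> < 2 * pi" "x = r *\<^sub>R circle_pt \<theta>"
proof (cases "x = 0")
  case False
  have "(x $ 1 / norm x)\<^sup>2 + (x $ 2 / norm x)\<^sup>2 = (x \<bullet> x) / (norm x)\<^sup>2"
    by (simp add: inner_vec_def sum_2 power_divide add_divide_distrib power2_eq_square)
  also have "\<dots> = 1" using False by (simp add: power2_norm_eq_inner)
  finally have "(x $ 1 / norm x)\<^sup>2 + (x $ 2 / norm x)\<^sup>2 = 1" .
  then obtain t where t: "0 \<le> t" "t < 2 * pi" "x $ 1 / norm x = cos t" "x $ 2 / norm x = sin t"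
    by (rule sincos_total_2pi) (rule that)
  then have "x = norm x *\<^sub>R circle_pt t"
    using False by (simp add: vec_eq_iff forall_2 flip: t(3,4))
  then show thesis using that[of "norm x" t] t(1,2) by simp
qed (use that[of 0 0] pi_gt_zero in auto)

lemma has_vector_derivative_circle_pt:
  "(circle_pt has_vector_derivative vector [- sin \<theta>, cos \<theta>]) (at \<theta> within T)"
proof -
  have *: "vector [a, b] = a *\<^sub>R axis 1 1 + b *\<^sub>R (axis 2 1 :: real ^ 2)" for a b
    by (simp add: vec_eq_iff forall_2 axis_def)
  show ?thesis
    unfolding circle_pt_def[abs_def] * 
    by (auto intro!: derivative_eq_intros)
qed

lemma continuous_on_circle_pt [continuous_intros]:
  assumes "continuous_on S f"
  shows "continuous_on S (\<lambda>x. circle_pt (f x))"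
proof -
  have "continuous_on UNIV circle_pt"
    by (rule continuous_on_vector_derivative) (rule has_vector_derivative_circle_pt)
  then show ?thesis
    using assms by (rule continuous_on_compose2) auto
qed

lemma DERIV_compose_partial_deriv:
  fixes f :: "real ^ 'n \<Rightarrow> real"
  assumes "f differentiable (at (\<gamma> t))" "(\<gamma> has_vector_derivative v) (at t within T)"
  shows "((\<lambda>t. f (\<gamma> t)) has_real_derivative (\<Sum>i\<in>UNIV. v $ i * partial_deriv i f (\<gamma> t))) (at t within T)"
proof -
  have "(f has_derivative (\<lambda>h. \<Sum>i\<in>UNIV. h $ i * partial_deriv i f (\<gamma> t))) (at (\<gamma> t))"
    by (rule has_derivative_partial_deriv[OF assms(1)])
  from has_derivative_compose[OF assms(2)[unfolded has_vector_derivative_def] this]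
  show ?thesis
    by (rule has_derivative_imp_has_field_derivative) (simp add: sum_distrib_left mult_ac)
qed

lemma continuous_on_polar:
  assumes "continuous_on (ball 0 1) f"
  shows "continuous_on ({-1<..<1} \<times> S) (\<lambda>(r, \<theta>). f (r *\<^sub>R circle_pt \<theta>))"
  unfolding split_beta
  by (rule continuous_on_compose2[OF assms]) (auto intro!: continuous_intros)

lemma DERIV_polar_radius:
  assumes "f differentiable (at (r *\<^sub>R circle_pt \<theta>))"
  shows "((\<lambda>r. f (r *\<^sub>R circle_pt \<theta>)) has_real_derivative
      cos \<theta> * partial_deriv 1 f (r *\<^sub>R circle_pt \<theta>) + sin \<theta> * partial_deriv 2 f (r *\<^sub>R circle_pt \<theta>))
     (at r within T)"
proof -
  have "((\<lambda>r. r *\<^sub>R circle_pt \<theta>) has_vector_derivative circle_pt \<theta>) (at r within T)"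
    by (auto intro!: derivative_eq_intros)
  from DERIV_compose_partial_deriv[OF assms this] show ?thesis
    by (simp add: sum_2)
qed

lemma DERIV_polar_angle:
  assumes "f differentiable (at (r *\<^sub>R circle_pt \<theta>))"
  shows "((\<lambda>\<theta>. f (r *\<^sub>R circle_pt \<theta>)) has_real_derivative
      r * (cos \<theta> * partial_deriv 2 f (r *\<^sub>R circle_pt \<theta>) - sin \<theta> * partial_deriv 1 f (r *\<^sub>R circle_pt \<theta>)))
     (at \<theta> within T)"
proof -
  have "((\<lambda>\<theta>. r *\<^sub>R circle_pt \<theta>) has_vector_derivative r *\<^sub>R vector [- sin \<theta>, cos \<theta>]) (at \<theta> within T)"
    by (auto intro!: derivative_eq_intros has_vector_derivative_circle_pt)
  from DERIV_compose_partial_deriv[OF assms this] show ?thesis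
    by (simp add: sum_2 algebra_simps)
qed

text \<open>The Fourier coefficient without its normalising factor. \<open>T\<close> is an arbitrary
  weight, since differentiating in \<open>r\<close> produces the weights
  \<open>cos \<theta> * T \<theta>\<close> and \<open>sin \<theta> * T \<theta>\<close>. Negative
  \<open>r\<close> is meaningful and makes \<open>r = 0\<close> an interior point.\<close>

definition angular :: "(real \<Rightarrow> real) \<Rightarrow> (real ^ 2 \<Rightarrow> real) \<Rightarrow> real \<Rightarrow> real" where
  "angular T f r = integral {0..2 * pi} (\<lambda>\<theta>. f (r *\<^sub>R circle_pt \<theta>) * T \<theta>)"

lemma has_integral_angular:
  assumes "continuous_on (ball 0 1) f" "continuous_on UNIV T" "\<bar>r\<bar> < 1"
  shows "((\<lambda>\<theta>. f (r *\<^sub>R circle_pt \<theta>) * T \<theta>) has_integral angular T f r) {0..2 * pi}"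
proof -
  have "continuous_on {0..2 * pi} (\<lambda>\<theta>. f (r *\<^sub>R circle_pt \<theta>) * T \<theta>)"
    using assms(3) by (intro continuous_on_mult continuous_on_compose2[OF assms(1)] continuous_on_subset[OF assms(2)])
      (auto intro!: continuous_intros)
  then show ?thesis
    unfolding angular_def by (intro integrable_integral integrable_continuous_interval)
qed

lemma angular_lincomb:
  assumes "continuous_on (ball 0 1) f" "continuous_on (ball 0 1) g" "continuous_on UNIV T" "\<bar>r\<bar> < 1"
  shows "angular T (\<lambda>x. a * f x + b * g x) r = a * angular T f r + b * angular T g r"
proof (rule has_integral_unique)
  show "((\<lambda>\<theta>. (a * f (r *\<^sub>R circle_pt \<theta>) + b * g (r *\<^sub>R circle_pt \<theta>)) * T \<theta>) has_integral
      angular T (\<lambda>x. a * f x + b * g x) r) {0..2 * pi}"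
    using assms by (intro has_integral_angular[of "\<lambda>x. a * f x + b * g x"] continuous_intros)
  have "((\<lambda>\<theta>. a * (f (r *\<^sub>R circle_pt \<theta>) * T \<theta>) + b * (g (r *\<^sub>R circle_pt \<theta>) * T \<theta>)) has_integral
      a * angular T f r + b * angular T g r) {0..2 * pi}"
    using assms by (intro has_integral_add has_integral_mult_right has_integral_angular)
  then show "((\<lambda>\<theta>. (a * f (r *\<^sub>R circle_pt \<theta>) + b * g (r *\<^sub>R circle_pt \<theta>)) * T \<theta>) has_integral
      a * angular T f r + b * angular T g r) {0..2 * pi}"
    by (simp add: algebra_simps)
qed

lemma DERIV_angular:
  assumes f: "Ck_on 1 f (ball 0 1)" and T: "continuous_on UNIV T" and r: "\<bar>r\<bar> < 1"
  shows "(angular T f has_real_derivative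
      angular (\<lambda>\<theta>. cos \<theta> * T \<theta>) (partial_deriv 1 f) r + angular (\<lambda>\<theta>. sin \<theta> * T \<theta>) (partial_deriv 2 f) r) (at r)"
proof -
  let ?g = "\<lambda>r \<theta>. (cos \<theta> * partial_deriv 1 f (r *\<^sub>R circle_pt \<theta>)
      + sin \<theta> * partial_deriv 2 f (r *\<^sub>R circle_pt \<theta>)) * T \<theta>"
  have d: "f differentiable (at x)" if "x \<in> ball 0 1" for x
    using f that by simp
  have c: "continuous_on (ball 0 1) f" by (rule Ck_on_imp_continuous_on[OF f])
  have p: "continuous_on (ball 0 1) (partial_deriv i f)" for i
    using f by simp
  have "((\<lambda>r. integral (cbox 0 (2 * pi)) (\<lambda>\<theta>. f (r *\<^sub>R circle_pt \<theta>) * T \<theta>)) has_field_derivative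
      integral (cbox 0 (2 * pi)) (?g r)) (at r within {-1<..<1})"
  proof (rule leibniz_rule_field_derivative)
    fix x t :: real assume "x \<in> {-1<..<1}"
    then show "((\<lambda>x. f (x *\<^sub>R circle_pt t) * T t) has_real_derivative ?g x t) (at x within {-1<..<1})"
      by (intro DERIV_cmult_right DERIV_polar_radius d) auto
  next
    fix x :: real assume "x \<in> {-1<..<1}"
    then show "(\<lambda>\<theta>. f (x *\<^sub>R circle_pt \<theta>) * T \<theta>) integrable_on cbox 0 (2 * pi)"
      using has_integral_angular[OF c T, of x] by (auto simp: integrable_on_def abs_less_iff)
  next
    show "continuous_on ({- 1<..<1} \<times> cbox 0 (2 * pi)) (\<lambda>(x, t). ?g x t)"
      using continuous_on_polar[OF p, where S = "cbox 0 (2 * pi)"] continuous_on_subset[OF T subset_UNIV]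
      unfolding split_beta
      by (intro continuous_intros continuous_on_compose2[OF T]) auto
  qed (use r in auto)
  moreover have "at r within {-1<..<1} = at r"
    using r by (intro at_within_open) auto
  moreover have "integral (cbox 0 (2 * pi)) (?g r) =
      angular (\<lambda>\<theta>. cos \<theta> * T \<theta>) (partial_deriv 1 f) r + angular (\<lambda>\<theta>. sin \<theta> * T \<theta>) (partial_deriv 2 f) r"
  proof (rule integral_unique)
    have "((\<lambda>\<theta>. partial_deriv 1 f (r *\<^sub>R circle_pt \<theta>) * (cos \<theta> * T \<theta>)
        + partial_deriv 2 f (r *\<^sub>R circle_pt \<theta>) * (sin \<theta> * T \<theta>)) has_integral
      angular (\<lambda>\<theta>. cos \<theta> * T \<theta>) (partial_deriv 1 f) r + angular (\<lambda>\<theta>. sin \<theta> * T \<theta>) (partial_deriv 2 f) r)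
      {0..2 * pi}"
      using T by (intro has_integral_add has_integral_angular p continuous_intros r)
    then show "(?g r has_integral angular (\<lambda>\<theta>. cos \<theta> * T \<theta>) (partial_deriv 1 f) r
       + angular (\<lambda>\<theta>. sin \<theta> * T \<theta>) (partial_deriv 2 f) r) (cbox 0 (2 * pi))"
      by (simp add: algebra_simps)
  qed
  ultimately show ?thesis
    by (simp add: angular_def[abs_def])
qed

text \<open>The derivative of \<open>angular T f\<close> in \<open>r\<close>, written through
  coefficients of the partial derivatives: in this form it can be differentiated again and passes to
  the rim when the partial derivatives extend continuously.\<close>

definition angular_deriv :: "(real \<Rightarrow> real) \<Rightarrow> (real ^ 2 \<Rightarrow> real) \<Rightarrow> real \<Rightarrow> real" where
  "angular_deriv T f r =
    angular (\<lambda>\<theta>. cos \<theta> * T \<theta>) (partial_deriv 1 f) r + angular (\<lambda>\<theta>. sin \<theta> * T \<theta>) (partial_deriv 2 f) r"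

text \<open>The integrand identity of \<open>angular_ode\<close>: \<open>C\<close>, \<open>S\<close>
  stand for cosine and sine, \<open>A1\<close>, \<open>A2\<close> and \<open>A11\<close> to
  \<open>A22\<close> for first and second partial derivatives. The subtracted bracket will integrate
  to 0 by periodicity; the terms in \<open>A12\<close> and in \<open>A21\<close> match
  separately.\<close>

lemma polar_laplacian_identity:
  fixes C S :: real
  assumes "s * F = A11 + A22" "C\<^sup>2 + S\<^sup>2 = 1"
  shows "(K + s * r\<^sup>2) * (F * T)
      - (r * (C * (r * (C * A22 - S * A21)) - S * A2 - (S * (r * (C * A12 - S * A11)) + C * A1)) * T + K * (F * T))
    = r\<^sup>2 * ((A11 * (C * (C * T)) + A12 * (S * (C * T))) + (A21 * (C * (S * T)) + A22 * (S * (S * T))))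
      + r * (A1 * (C * T) + A2 * (S * T))"
proof -
  have "s * F * (r\<^sup>2 * T) = (A11 + A22) * (C\<^sup>2 + S\<^sup>2) * (r\<^sup>2 * T)"
    using assms by simp
  then show ?thesis by (simp add: algebra_simps power2_eq_square)
qed

text \<open>In polar coordinates \<open>r\<^sup>2 \<Delta>f = r\<^sup>2 f\<^sub>r\<^sub>r + r f\<^sub>r + f\<^sub>\<theta>\<^sub>\<theta>\<close>, and \<open>f\<^sub>\<theta>\<^sub>\<theta>\<close> contributes \<open>- K\<close> times the
  coefficient after two integrations by parts.\<close>

lemma angular_ode:
  assumes f: "Ck_on 2 f (ball 0 1)"
    and lap: "\<And>x. x \<in> ball 0 1 \<Longrightarrow> laplacian f x = s * f x"
    and T: "\<And>\<theta>. (T has_real_derivative T' \<theta>) (at \<theta>)" "\<And>\<theta>. (T' has_real_derivative - K * T \<theta>) (at \<theta>)"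
    and per: "T (2 * pi) = T 0" "T' (2 * pi) = T' 0"
    and r: "\<bar>r\<bar> < 1"
  obtains w where "(angular_deriv T f has_real_derivative w) (at r)"
    "r\<^sup>2 * w + r * angular_deriv T f r = (K + s * r\<^sup>2) * angular T f r"
proof -
  have cT: "continuous_on UNIV T" "continuous_on UNIV T'"
    using T by (meson DERIV_continuous_on has_field_derivative_at_within)+
  have f1: "Ck_on 1 f (ball 0 1)" using Ck_on_le[OF f, of 1] by simp
  have p: "Ck_on 1 (partial_deriv i f) (ball 0 1)" for i
    using f by (simp add: numeral_2_eq_2)
  note c = Ck_on_imp_continuous_on[OF f1] Ck_on_imp_continuous_on[OF p]
  have pp: "continuous_on (ball 0 1) (partial_deriv j (partial_deriv i f))" for i j
    using p[of i] by simp
  define w where "w =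
     (angular (\<lambda>\<theta>. cos \<theta> * (cos \<theta> * T \<theta>)) (partial_deriv 1 (partial_deriv 1 f)) r
      + angular (\<lambda>\<theta>. sin \<theta> * (cos \<theta> * T \<theta>)) (partial_deriv 2 (partial_deriv 1 f)) r)
   + (angular (\<lambda>\<theta>. cos \<theta> * (sin \<theta> * T \<theta>)) (partial_deriv 1 (partial_deriv 2 f)) r
      + angular (\<lambda>\<theta>. sin \<theta> * (sin \<theta> * T \<theta>)) (partial_deriv 2 (partial_deriv 2 f)) r)"
  show thesis
  proof (rule that)
    show "(angular_deriv T f has_real_derivative w) (at r)"
      unfolding angular_deriv_def[abs_def] w_def
      using cT by (intro DERIV_add DERIV_angular p r continuous_intros)
    let ?x = "\<lambda>\<theta>. r *\<^sub>R circle_pt \<theta>"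
    let ?p = "\<lambda>i \<theta>. partial_deriv i f (?x \<theta>)"
    let ?pp = "\<lambda>i j \<theta>. partial_deriv j (partial_deriv i f) (?x \<theta>)"
    let ?q = "\<lambda>\<theta>. r * (cos \<theta> * ?p 2 \<theta> - sin \<theta> * ?p 1 \<theta>)"
    let ?q' = "\<lambda>\<theta>. r * (cos \<theta> * (r * (cos \<theta> * ?pp 2 2 \<theta> - sin \<theta> * ?pp 2 1 \<theta>)) - sin \<theta> * ?p 2 \<theta>
                   - (sin \<theta> * (r * (cos \<theta> * ?pp 1 2 \<theta> - sin \<theta> * ?pp 1 1 \<theta>)) + cos \<theta> * ?p 1 \<theta>))"
    have x: "?x \<theta> \<in> ball 0 1" for \<theta> using r by simp
    have d: "f differentiable (at (?x \<theta>))" "partial_deriv i f differentiable (at (?x \<theta>))" for i \<theta>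
      using f1 p[of i] x by auto
    \<comment> \<open>\<open>?q\<close> and \<open>?q'\<close> are the first two angular derivatives
      of \<open>f\<close>. The function differentiated here is the boundary term of both
      integrations by parts together; the two products \<open>?q \<theta> * T' \<theta>\<close>
      cancel in its derivative.\<close>
    have "((\<lambda>\<theta>. ?q \<theta> * T \<theta> - f (?x \<theta>) * T' \<theta>) has_real_derivative ?q' \<theta> * T \<theta> + K * (f (?x \<theta>) * T \<theta>)) (at \<theta>)" for \<theta>
    proof -
      have q: "(?q has_real_derivative ?q' \<theta>) (at \<theta>)"
        by (rule derivative_eq_intros DERIV_polar_angle d refl)+ (simp add: algebra_simps)
      show ?thesis
        by (rule derivative_eq_intros q T DERIV_polar_angle d refl)+ (simp add: algebra_simps)
    qed
    then have "((\<lambda>\<theta>. ?q' \<theta> * T \<theta> + K * (f (?x \<theta>) * T \<theta>)) has_integral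
       (?q (2 * pi) * T (2 * pi) - f (?x (2 * pi)) * T' (2 * pi)) - (?q 0 * T 0 - f (?x 0) * T' 0)) {0..2 * pi}"
      by (intro fundamental_theorem_of_calculus)
        (auto simp: has_real_derivative_iff_has_vector_derivative intro: has_vector_derivative_at_within)
    moreover have "circle_pt (2 * pi) = circle_pt 0" by (simp add: circle_pt_def)
    ultimately have "((\<lambda>\<theta>. ?q' \<theta> * T \<theta> + K * (f (?x \<theta>) * T \<theta>)) has_integral 0) {0..2 * pi}"
      by (simp add: per)
    moreover have "((\<lambda>\<theta>. (K + s * r\<^sup>2) * (f (?x \<theta>) * T \<theta>)) has_integral (K + s * r\<^sup>2) * angular T f r) {0..2 * pi}"
      using cT by (intro has_integral_mult_right has_integral_angular c r)
    ultimately have 1: "((\<lambda>\<theta>. (K + s * r\<^sup>2) * (f (?x \<theta>) * T \<theta>) - (?q' \<theta> * T \<theta> + K * (f (?x \<theta>) * T \<theta>)))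
        has_integral (K + s * r\<^sup>2) * angular T f r - 0) {0..2 * pi}"
      by (rule has_integral_diff[rotated])
    have 2: "((\<lambda>\<theta>. r\<^sup>2 * ((?pp 1 1 \<theta> * (cos \<theta> * (cos \<theta> * T \<theta>)) + ?pp 1 2 \<theta> * (sin \<theta> * (cos \<theta> * T \<theta>)))
        + (?pp 2 1 \<theta> * (cos \<theta> * (sin \<theta> * T \<theta>)) + ?pp 2 2 \<theta> * (sin \<theta> * (sin \<theta> * T \<theta>))))
        + r * (?p 1 \<theta> * (cos \<theta> * T \<theta>) + ?p 2 \<theta> * (sin \<theta> * T \<theta>)))
       has_integral r\<^sup>2 * w + r * angular_deriv T f r) {0..2 * pi}"
      unfolding w_def angular_deriv_def
      using cT by (intro has_integral_add has_integral_mult_right has_integral_angular pp c r continuous_intros)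
    have eq: "(K + s * r\<^sup>2) * (f (?x \<theta>) * T \<theta>) - (?q' \<theta> * T \<theta> + K * (f (?x \<theta>) * T \<theta>))
      = r\<^sup>2 * ((?pp 1 1 \<theta> * (cos \<theta> * (cos \<theta> * T \<theta>)) + ?pp 1 2 \<theta> * (sin \<theta> * (cos \<theta> * T \<theta>)))
        + (?pp 2 1 \<theta> * (cos \<theta> * (sin \<theta> * T \<theta>)) + ?pp 2 2 \<theta> * (sin \<theta> * (sin \<theta> * T \<theta>))))
        + r * (?p 1 \<theta> * (cos \<theta> * T \<theta>) + ?p 2 \<theta> * (sin \<theta> * T \<theta>))" for \<theta>
    proof (rule polar_laplacian_identity)
      show "s * f (?x \<theta>) = ?pp 1 1 \<theta> + ?pp 2 2 \<theta>"
        using lap[OF x, of \<theta>] by (simp add: laplacian_def sum_2)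
    qed simp
    show "r\<^sup>2 * w + r * angular_deriv T f r = (K + s * r\<^sup>2) * angular T f r"
      using has_integral_unique[OF 1[unfolded eq] 2] by simp
  qed
qed


section \<open>Completeness of the trigonometric system on the circle\<close>

text \<open>The index runs over all integers because multiplication by a coordinate shifts it by 1
  in both directions.\<close>

definition trig_orthogonal :: "(real ^ 2 \<Rightarrow> real) \<Rightarrow> bool" where
  "trig_orthogonal f \<longleftrightarrow> continuous_on (sphere 0 1) f \<and>
     (\<forall>k::int. ((\<lambda>\<theta>. f (circle_pt \<theta>) * cos (of_int k * \<theta>)) has_integral 0) {0..2 * pi} \<and>
               ((\<lambda>\<theta>. f (circle_pt \<theta>) * sin (of_int k * \<theta>)) has_integral 0) {0..2 * pi})"

lemma trig_orthogonal_lincomb: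
  assumes "trig_orthogonal f" "trig_orthogonal g"
  shows "trig_orthogonal (\<lambda>x. a * f x + b * g x)"
proof -
  have "((\<lambda>\<theta>. (a * f (circle_pt \<theta>) + b * g (circle_pt \<theta>)) * cos (of_int k * \<theta>)) has_integral 0) {0..2 * pi}"
    "((\<lambda>\<theta>. (a * f (circle_pt \<theta>) + b * g (circle_pt \<theta>)) * sin (of_int k * \<theta>)) has_integral 0) {0..2 * pi}" for k :: int
    using assms has_integral_add[OF has_integral_mult_right[of "\<lambda>\<theta>. f (circle_pt \<theta>) * cos (of_int k * \<theta>)" 0 _ a]
       has_integral_mult_right[of "\<lambda>\<theta>. g (circle_pt \<theta>) * cos (of_int k * \<theta>)" 0 _ b]]
     has_integral_add[OF has_integral_mult_right[of "\<lambda>\<theta>. f (circle_pt \<theta>) * sin (of_int k * \<theta>)" 0 _ a]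
       has_integral_mult_right[of "\<lambda>\<theta>. g (circle_pt \<theta>) * sin (of_int k * \<theta>)" 0 _ b]]
    by (auto simp: trig_orthogonal_def algebra_simps)
  then show ?thesis
    using assms by (auto simp: trig_orthogonal_def intro!: continuous_intros)
qed

text \<open>On the circle the coordinates are cosine and sine, and the product-to-sum formulas
  express the new integrands of index k through the old ones of index k + 1 and k - 1.\<close>

lemma trig_orthogonal_mult_component:
  assumes "trig_orthogonal f"
  shows "trig_orthogonal (\<lambda>x. x $ i * f x)"
proof -
  let ?c = "\<lambda>k \<theta>. f (circle_pt \<theta>) * cos (of_int k * \<theta>)"
  let ?s = "\<lambda>k \<theta>. f (circle_pt \<theta>) * sin (of_int k * \<theta>)"
  have cs: "(?c k has_integral 0) {0..2 * pi}" "(?s k has_integral 0) {0..2 * pi}" for k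
    using assms by (auto simp: trig_orthogonal_def)
  have half: "((\<lambda>\<theta>. 1 / 2 * (g \<theta> + c * h \<theta>)) has_integral 0) {0..2 * pi}"
    if "(g has_integral 0) {0..2 * pi}" "(h has_integral 0) {0..2 * pi}" for g h :: "real \<Rightarrow> real" and c
    using has_integral_mult_right[OF has_integral_add[OF that(1) has_integral_mult_right[OF that(2), of c]], of "1 / 2"]
    by simp
  have exp: "of_int (k + 1) * \<theta> = of_int k * \<theta> + \<theta>" "of_int (k - 1) * \<theta> = of_int k * \<theta> - \<theta>" for k \<theta>
    by (simp_all add: algebra_simps)
  have "((\<lambda>\<theta>. (circle_pt \<theta> $ 1 * f (circle_pt \<theta>)) * cos (of_int k * \<theta>)) has_integral 0) {0..2 * pi}"
    "((\<lambda>\<theta>. (circle_pt \<theta> $ 1 * f (circle_pt \<theta>)) * sin (of_int k * \<theta>)) has_integral 0) {0..2 * pi}"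
    "((\<lambda>\<theta>. (circle_pt \<theta> $ 2 * f (circle_pt \<theta>)) * cos (of_int k * \<theta>)) has_integral 0) {0..2 * pi}"
    "((\<lambda>\<theta>. (circle_pt \<theta> $ 2 * f (circle_pt \<theta>)) * sin (of_int k * \<theta>)) has_integral 0) {0..2 * pi}" for k :: int
    using half[OF cs(1)[of "k + 1"] cs(1)[of "k - 1"], of 1] half[OF cs(2)[of "k + 1"] cs(2)[of "k - 1"], of 1]
      half[OF cs(2)[of "k + 1"] cs(2)[of "k - 1"], of "- 1"] half[OF cs(1)[of "k - 1"] cs(1)[of "k + 1"], of "- 1"]
    unfolding exp cos_add sin_add cos_diff sin_diff
    by (simp_all add: algebra_simps)
  then have "\<forall>k::int. ((\<lambda>\<theta>. (circle_pt \<theta> $ i * f (circle_pt \<theta>)) * cos (of_int k * \<theta>)) has_integral 0) {0..2 * pi} \<and>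
     ((\<lambda>\<theta>. (circle_pt \<theta> $ i * f (circle_pt \<theta>)) * sin (of_int k * \<theta>)) has_integral 0) {0..2 * pi}"
    using exhaust_2[of i] by auto
  moreover have "continuous_on (sphere 0 1) (\<lambda>x. x $ i * f x)"
    using assms by (auto simp: trig_orthogonal_def intro!: continuous_intros)
  ultimately show ?thesis unfolding trig_orthogonal_def by blast
qed

text \<open>Polynomials are generated by constants and linear forms, hence by the coordinates. The
  function \<open>f\<close> stays arbitrary in the induction, since \<open>p * q\<close> acts on
  \<open>f\<close> as \<open>p\<close> acts on \<open>q * f\<close>.\<close>

lemma trig_orthogonal_mult_polynomial:
  assumes "real_polynomial_function p" "trig_orthogonal f"
  shows "trig_orthogonal (\<lambda>x. p x * f x)"
  using assms
proof (induction p arbitrary: f rule: real_polynomial_function.induct)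
  case (linear h)
  then interpret bounded_linear h by simp
  have h: "h x = h (axis 1 1) * x $ 1 + h (axis 2 1) * x $ 2" for x
  proof -
    have "h x = h (x $ 1 *\<^sub>R axis 1 1 + x $ 2 *\<^sub>R axis 2 1)"
      by (rule arg_cong[of _ _ h]) (simp add: vec_eq_iff forall_2 axis_def)
    then show ?thesis by (simp add: add scaleR)
  qed
  have "trig_orthogonal (\<lambda>x. h (axis 1 1) * (x $ 1 * f x) + h (axis 2 1) * (x $ 2 * f x))"
    by (intro trig_orthogonal_lincomb trig_orthogonal_mult_component linear.prems)
  then show ?case by (subst h) (simp add: algebra_simps)
next
  case (const c)
  then show ?case using trig_orthogonal_lincomb[OF const const, of c 0] by simp
next
  case (add p q)
  then show ?case using trig_orthogonal_lincomb[OF add.IH(1)[of f] add.IH(2)[of f], of 1 1]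
    by (simp add: algebra_simps)
next
  case (mult p q)
  then show ?case using mult.IH(1)[OF mult.IH(2)[of f]] by (simp add: mult.assoc)
qed

text \<open>Mode 0 of \<open>p * f\<close> gives \<open>\<integral> p f = 0\<close> for every
  polynomial \<open>p\<close>, so \<open>\<integral> f^2 = \<integral> (f - p) f\<close>. By
  Stone-Weierstrass \<open>p\<close> can be chosen uniformly close to \<open>f\<close>, which forces
  \<open>\<integral> f^2 = 0\<close>.\<close>

lemma trig_orthogonal_eq_0:
  assumes "trig_orthogonal f"
  shows "f (circle_pt \<theta>) = 0"
proof -
  have cf: "continuous_on (sphere 0 1) f"
    using assms by (simp add: trig_orthogonal_def)
  have cp: "continuous_on S (\<lambda>\<theta>. g (circle_pt \<theta>))" if "continuous_on (sphere 0 1) g" for S :: "real set" and g :: "real ^ 2 \<Rightarrow> real"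
    by (rule continuous_on_compose2[OF that]) (auto intro!: continuous_intros)
  obtain M where "\<forall>y\<in>f ` sphere 0 1. norm y \<le> M"
    using compact_imp_bounded[OF compact_continuous_image[OF cf compact_sphere]]
    unfolding bounded_iff by blast
  then have M: "\<bar>f x\<bar> \<le> M" if "x \<in> sphere 0 1" for x
    using that by simp
  have "0 \<le> \<bar>f (circle_pt 0)\<bar>" by simp
  also have "\<dots> \<le> M" by (rule M) simp
  finally have "0 \<le> M" .
  let ?I = "integral {0..2 * pi} (\<lambda>\<theta>. (f (circle_pt \<theta>))\<^sup>2)"
  have sq: "((\<lambda>\<theta>. (f (circle_pt \<theta>))\<^sup>2) has_integral ?I) {0..2 * pi}"
    by (intro integrable_integral integrable_continuous_interval continuous_intros cp cf)
  have "?I \<le> e" if "0 < e" for e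
  proof -
    \<comment> \<open>Chosen so that the final bound \<open>2 * pi * (d * (M + 1))\<close> is
      \<open>e\<close>; \<open>M + 1\<close> keeps the denominator nonzero when
      \<open>M = 0\<close>.\<close>
    define d where "d = e / (2 * pi * (M + 1))"
    have "0 < d" using that \<open>0 \<le> M\<close> by (simp add: d_def)
    obtain p where p: "real_polynomial_function p" "\<And>x. x \<in> sphere 0 1 \<Longrightarrow> \<bar>f x - p x\<bar> < d"
      by (rule Stone_Weierstrass_real_polynomial_function[OF compact_sphere cf \<open>0 < d\<close>]) (rule that)
    have "((\<lambda>\<theta>. p (circle_pt \<theta>) * f (circle_pt \<theta>) * cos (of_int 0 * \<theta>)) has_integral 0) {0..2 * pi}"
      using trig_orthogonal_mult_polynomial[OF p(1) assms] unfolding trig_orthogonal_def by blast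
    then have "((\<lambda>\<theta>. (f (circle_pt \<theta>))\<^sup>2 - p (circle_pt \<theta>) * f (circle_pt \<theta>)) has_integral ?I - 0) {0..2 * pi}"
      by (intro has_integral_diff sq) simp
    moreover have "((\<lambda>\<theta>. d * (M + 1)) has_integral (2 * pi - 0) * (d * (M + 1))) {0..2 * pi}"
      using has_integral_const_real[of "d * (M + 1)" 0 "2 * pi"] by simp
    ultimately have "?I - 0 \<le> (2 * pi - 0) * (d * (M + 1))"
    proof (rule has_integral_le)
      fix \<theta> :: real
      have "(f (circle_pt \<theta>))\<^sup>2 - p (circle_pt \<theta>) * f (circle_pt \<theta>)
          \<le> \<bar>f (circle_pt \<theta>) - p (circle_pt \<theta>)\<bar> * \<bar>f (circle_pt \<theta>)\<bar>"
        by (simp flip: abs_mult add: power2_eq_square left_diff_distrib)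
      also have "\<dots> \<le> d * (M + 1)"
        using p(2)[of "circle_pt \<theta>"] M[of "circle_pt \<theta>"] \<open>0 < d\<close> by (intro mult_mono) auto
      finally show "(f (circle_pt \<theta>))\<^sup>2 - p (circle_pt \<theta>) * f (circle_pt \<theta>) \<le> d * (M + 1)" .
    qed
    also have "\<dots> = e" using \<open>0 \<le> M\<close> by (simp add: d_def)
    finally show ?thesis by simp
  qed
  then have "?I \<le> 0" by (rule field_le_epsilon[of ?I 0, simplified])
  moreover have "0 \<le> ?I" using sq by (rule has_integral_nonneg) simp
  ultimately have "?I = 0" by simp
  then have zero: "\<forall>\<theta>\<in>{0..2 * pi}. (f (circle_pt \<theta>))\<^sup>2 = 0"
    by (subst (asm) integral_eq_0_iff) (auto intro!: continuous_intros cp cf)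
  obtain r t where "0 \<le> r" "0 \<le> t" "t < 2 * pi" and eq: "circle_pt \<theta> = r *\<^sub>R circle_pt t"
    by (rule circle_pt_exhaust)
  have "1 = norm (r *\<^sub>R circle_pt t)" unfolding eq[symmetric] by simp
  then have "r = 1" using \<open>0 \<le> r\<close> by simp
  with eq zero \<open>0 \<le> t\<close> \<open>t < 2 * pi\<close> show ?thesis by auto
qed

lemma has_integral_cos_0: 
  assumes "k \<noteq> 0" shows "((\<lambda>\<theta>. cos (of_int k * \<theta>)) has_integral 0) {0..2 * pi}"
proof -
  have "((\<lambda>\<theta>. cos (of_int k * \<theta>)) has_integral
      sin (of_int k * (2 * pi)) / of_int k - sin (of_int k * 0) / of_int k) {0..2 * pi}"
    using assms by (intro fundamental_theorem_of_calculus)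
      (auto intro!: derivative_eq_intros simp flip: has_real_derivative_iff_has_vector_derivative)
  moreover have "sin (of_int k * (2 * pi)) = 0"
    using sin_int_2pin[of k] by (simp add: mult_ac)
  ultimately show ?thesis by simp
qed

lemma has_integral_sin_0: "((\<lambda>\<theta>. sin (of_int k * \<theta>)) has_integral 0) {0..2 * pi}"
proof (cases "k = 0")
  case False
  have "((\<lambda>\<theta>. sin (of_int k * \<theta>)) has_integral
      - cos (of_int k * (2 * pi)) / of_int k - - cos (of_int k * 0) / of_int k) {0..2 * pi}"
    using False by (intro fundamental_theorem_of_calculus)
      (auto intro!: derivative_eq_intros simp flip: has_real_derivative_iff_has_vector_derivative)
  moreover have "cos (of_int k * (2 * pi)) = 1"
    using cos_int_2pin[of k] by (simp add: mult_ac)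
  ultimately show ?thesis by simp
qed simp

lemma fourier_coefficients_zero_imp_const:
  assumes cf: "continuous_on (sphere 0 1) f"
    and coeff: "\<And>k::nat. 0 < k \<Longrightarrow> integral {0..2 * pi} (\<lambda>\<theta>. f (circle_pt \<theta>) * cos (real k * \<theta>)) = 0"
      "\<And>k::nat. 0 < k \<Longrightarrow> integral {0..2 * pi} (\<lambda>\<theta>. f (circle_pt \<theta>) * sin (real k * \<theta>)) = 0"
  shows "f (circle_pt \<theta>) = integral {0..2 * pi} (\<lambda>\<theta>. f (circle_pt \<theta>)) / (2 * pi)"
proof -
  define m where "m = integral {0..2 * pi} (\<lambda>\<theta>. f (circle_pt \<theta>)) / (2 * pi)"
  have cp: "continuous_on S (\<lambda>\<theta>. f (circle_pt \<theta>))" for S :: "real set"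
    by (rule continuous_on_compose2[OF cf]) (auto intro!: continuous_intros)
  have I: "((\<lambda>\<theta>. f (circle_pt \<theta>) * T \<theta>) has_integral integral {0..2 * pi} (\<lambda>\<theta>. f (circle_pt \<theta>) * T \<theta>)) {0..2 * pi}"
    if "continuous_on {0..2 * pi} T" for T
    by (intro integrable_integral integrable_continuous_interval continuous_intros cp that)
  have pos: "((\<lambda>\<theta>. (f (circle_pt \<theta>) - m) * cos (of_int k * \<theta>)) has_integral 0) {0..2 * pi}"
    "((\<lambda>\<theta>. (f (circle_pt \<theta>) - m) * sin (of_int k * \<theta>)) has_integral 0) {0..2 * pi}" if "0 \<le> k" for k :: int
  proof -
    define n where "n = nat k"
    have n: "k = int n" using that by (simp add: n_def)
    have cont: "continuous_on {0..2 * pi} (\<lambda>\<theta>. sin (real n * \<theta>))"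
      "continuous_on {0..2 * pi} (\<lambda>\<theta>. cos (real n * \<theta>))"
      by (intro continuous_intros)+
    have s: "integral {0..2 * pi} (\<lambda>\<theta>. f (circle_pt \<theta>) * sin (real n * \<theta>)) = 0"
      using coeff(2)[of n] by (cases "n = 0") auto
    have "((\<lambda>\<theta>. f (circle_pt \<theta>) * sin (real n * \<theta>) - m * sin (real n * \<theta>)) has_integral 0 - m * 0) {0..2 * pi}"
      using I[of "\<lambda>\<theta>. sin (real n * \<theta>)", OF cont(1)] has_integral_sin_0[of n] unfolding s
      by (intro has_integral_diff has_integral_mult_right) auto
    then show "((\<lambda>\<theta>. (f (circle_pt \<theta>) - m) * sin (of_int k * \<theta>)) has_integral 0) {0..2 * pi}"
      by (simp add: n left_diff_distrib)
    show "((\<lambda>\<theta>. (f (circle_pt \<theta>) - m) * cos (of_int k * \<theta>)) has_integral 0) {0..2 * pi}"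
    proof (cases "n = 0")
      case True
      have "((\<lambda>\<theta>. f (circle_pt \<theta>) * 1 - m) has_integral
          integral {0..2 * pi} (\<lambda>\<theta>. f (circle_pt \<theta>) * 1) - (2 * pi - 0) * m) {0..2 * pi}"
        using has_integral_const_real[of m 0 "2 * pi"] by (intro has_integral_diff I) auto
      then show ?thesis using True n by (simp add: m_def)
    next
      case False
      have c: "integral {0..2 * pi} (\<lambda>\<theta>. f (circle_pt \<theta>) * cos (real n * \<theta>)) = 0"
        using coeff(1)[of n] False by auto
      have "((\<lambda>\<theta>. f (circle_pt \<theta>) * cos (real n * \<theta>) - m * cos (real n * \<theta>)) has_integral 0 - m * 0) {0..2 * pi}"
        using I[of "\<lambda>\<theta>. cos (real n * \<theta>)", OF cont(2)] has_integral_cos_0[of n] False unfolding c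
        by (intro has_integral_diff has_integral_mult_right) auto
      then show ?thesis by (simp add: n left_diff_distrib)
    qed
  qed
  have "((\<lambda>\<theta>. (f (circle_pt \<theta>) - m) * cos (of_int k * \<theta>)) has_integral 0) {0..2 * pi}"
    "((\<lambda>\<theta>. (f (circle_pt \<theta>) - m) * sin (of_int k * \<theta>)) has_integral 0) {0..2 * pi}" for k :: int
    \<comment> \<open>Negative indices reduce to positive ones because cosine is even and sine is
      odd.\<close>
    using pos[of k] pos[of "- k"] has_integral_neg[OF pos(2)[of "- k"]] by (cases "0 \<le> k"; simp)+
  then have "trig_orthogonal (\<lambda>x. f x - m)"
    using cf by (auto simp: trig_orthogonal_def intro!: continuous_intros)
  then have "f (circle_pt \<theta>) - m = 0"
    by (rule trig_orthogonal_eq_0)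
  then show ?thesis unfolding m_def by (rule eq_iff_diff_eq_0[THEN iffD2])
qed


section \<open>Regular solutions of the Bessel equation\<close>

text \<open>Up to a constant factor this is J_k(\<alpha> r) for \<open>s = - \<alpha>^2\<close> and
  I_k(\<beta> r) for \<open>s = \<beta>^2\<close>; \<open>s\<close> is the corresponding eigenvalue
  of the Laplacian.\<close>

definition bessel_profile :: "nat \<Rightarrow> real \<Rightarrow> real \<Rightarrow> real" where
  "bessel_profile k s r = r ^ k * clifford k (s * r\<^sup>2 / 4)"

text \<open>The Euler derivative \<open>r d/dr\<close> of the profile; unlike the derivative it needs no \<open>r ^ (k - 1)\<close>.\<close>

definition bessel_euler :: "nat \<Rightarrow> real \<Rightarrow> real \<Rightarrow> real" where
  "bessel_euler k s r = r ^ k * (k * clifford k (s * r\<^sup>2 / 4) + s * r\<^sup>2 / 2 * clifford (Suc k) (s * r\<^sup>2 / 4))"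

lemma DERIV_power_euler:
  assumes "r \<noteq> 0"
  shows "((\<lambda>r::real. r ^ k) has_real_derivative k * r ^ k / r) (at r within S)"
proof -
  have "((\<lambda>r::real. r ^ k) has_real_derivative real k * r ^ (k - Suc 0)) (at r within S)"
    by (auto intro!: derivative_eq_intros)
  moreover have "real k * r ^ (k - Suc 0) = k * r ^ k / r"
    using assms by (cases k) auto
  ultimately show ?thesis by simp
qed

lemma DERIV_clifford_square:
  "((\<lambda>r. clifford k (s * r\<^sup>2 / 4)) has_real_derivative clifford (Suc k) (s * r\<^sup>2 / 4) * (s * r / 2)) (at r)"
  by (auto intro!: derivative_eq_intros)

lemma DERIV_bessel_profile:
  assumes "r \<noteq> 0"
  shows "(bessel_profile k s has_real_derivative bessel_euler k s r / r) (at r)"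
  unfolding bessel_profile_def[abs_def] bessel_euler_def
  by (rule DERIV_cong[OF DERIV_mult[OF DERIV_power_euler[OF assms] DERIV_clifford_square]])
     (use assms in \<open>simp add: field_simps power2_eq_square\<close>)

text \<open>Bessel's equation in the form \<open>(r d/dr)^2 B = (k^2 + s r^2) B\<close>, obtained
  from \<open>clifford_rec\<close> at \<open>t = s r^2 / 4\<close>.\<close>

lemma DERIV_bessel_euler:
  assumes "r \<noteq> 0"
  shows "(bessel_euler k s has_real_derivative ((real k)\<^sup>2 + s * r\<^sup>2) * bessel_profile k s r / r) (at r)"
proof -
  let ?t = "s * r\<^sup>2 / 4"
  have "((\<lambda>r. k * clifford k (s * r\<^sup>2 / 4) + s * r\<^sup>2 / 2 * clifford (Suc k) (s * r\<^sup>2 / 4)) has_real_derivative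
     k * (clifford (Suc k) ?t * (s * r / 2))
       + (s * r * clifford (Suc k) ?t + s * r\<^sup>2 / 2 * (clifford (Suc (Suc k)) ?t * (s * r / 2)))) (at r)"
    by (auto intro!: derivative_eq_intros DERIV_clifford_square simp: algebra_simps add_divide_distrib)
  from DERIV_mult[OF DERIV_power_euler[OF assms, of k] this]
  have "(bessel_euler k s has_real_derivative
     k * r ^ k / r * (k * clifford k ?t + s * r\<^sup>2 / 2 * clifford (Suc k) ?t)
     + r ^ k * (k * (clifford (Suc k) ?t * (s * r / 2))
       + (s * r * clifford (Suc k) ?t + s * r\<^sup>2 / 2 * (clifford (Suc (Suc k)) ?t * (s * r / 2))))) (at r)"
    unfolding bessel_euler_def[abs_def] by (simp only: mult.commute[of _ "r ^ k"])
  also have "k * r ^ k / r * (k * clifford k ?t + s * r\<^sup>2 / 2 * clifford (Suc k) ?t)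
     + r ^ k * (k * (clifford (Suc k) ?t * (s * r / 2))
       + (s * r * clifford (Suc k) ?t + s * r\<^sup>2 / 2 * (clifford (Suc (Suc k)) ?t * (s * r / 2))))
     = r ^ k / r * ((real k)\<^sup>2 * clifford k ?t + s * r\<^sup>2 * (?t * clifford (Suc (Suc k)) ?t + real (Suc k) * clifford (Suc k) ?t))"
    using assms by (simp add: field_simps power2_eq_square)
  also have "\<dots> = ((real k)\<^sup>2 + s * r\<^sup>2) * bessel_profile k s r / r"
    unfolding clifford_rec bessel_profile_def by (simp add: algebra_simps add_divide_distrib)
  finally show ?thesis .
qed

text \<open>Negative radii are included, so that regularity at \<open>0\<close> is part of the condition.\<close>

definition bessel_solution :: "nat \<Rightarrow> real \<Rightarrow> (real \<Rightarrow> real) \<Rightarrow> (real \<Rightarrow> real) \<Rightarrow> bool" where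
  "bessel_solution k s w w1 \<longleftrightarrow> (\<forall>r. \<bar>r\<bar> < 1 \<longrightarrow> (w has_real_derivative w1 r) (at r) \<and>
     (\<exists>w2. (w1 has_real_derivative w2) (at r) \<and> r\<^sup>2 * w2 + r * w1 r = ((real k)\<^sup>2 + s * r\<^sup>2) * w r))"

lemma continuous_on_bessel_solution:
  assumes "bessel_solution k s w w1" "x < 1"
  shows "continuous_on {0..x} w" "continuous_on {0..x} w1"
proof -
  have "isCont w y \<and> isCont w1 y" if "y \<in> {0..x}" for y
  proof -
    have "\<bar>y\<bar> < 1" using that assms by simp
    then show ?thesis
      using assms(1) DERIV_isCont unfolding bessel_solution_def by blast
  qed
  then show "continuous_on {0..x} w" "continuous_on {0..x} w1"
    by (auto intro: continuous_at_imp_continuous_on)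
qed

text \<open>The Wronskian \<open>w (r B') - (r w') B\<close> is constant and vanishes at \<open>0\<close>.\<close>

lemma bessel_solution_wronskian:
  assumes w: "bessel_solution k s w w1" and x: "0 < x" "x < 1"
  shows "w x * bessel_euler k s x = x * w1 x * bessel_profile k s x"
proof -
  let ?W = "\<lambda>r. w r * bessel_euler k s r - r * w1 r * bessel_profile k s r"
  have "?W x = ?W 0"
  proof (rule DERIV_isconst_end[OF x(1)])
    show "continuous_on {0..x} ?W"
      unfolding bessel_profile_def bessel_euler_def
      by (intro continuous_intros continuous_on_bessel_solution[OF w x(2)]) auto
    fix r assume r: "0 < r" "r < x"
    then have "\<bar>r\<bar> < 1" using x by simp
    then obtain w2 where w1: "(w has_real_derivative w1 r) (at r)"
        and w2: "(w1 has_real_derivative w2) (at r)" "r\<^sup>2 * w2 + r * w1 r = ((real k)\<^sup>2 + s * r\<^sup>2) * w r"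
      using w unfolding bessel_solution_def by blast
    let ?B = "bessel_profile k s r" and ?N = "bessel_euler k s r"
    have nz: "r \<noteq> 0" using r by simp
    have "(?W has_real_derivative (w1 r * ?N + ((real k)\<^sup>2 + s * r\<^sup>2) * ?B / r * w r)
        - ((1 * w1 r + w2 * r) * ?B + ?N / r * (r * w1 r))) (at r)"
      by (intro DERIV_diff DERIV_mult' DERIV_mult w1 w2 DERIV_bessel_profile DERIV_bessel_euler DERIV_ident nz)
    moreover have "(w1 r * ?N + ((real k)\<^sup>2 + s * r\<^sup>2) * ?B / r * w r) - ((1 * w1 r + w2 * r) * ?B + ?N / r * (r * w1 r))
        = ?B / r * (((real k)\<^sup>2 + s * r\<^sup>2) * w r - (r\<^sup>2 * w2 + r * w1 r))"
      using nz by (simp add: field_simps power2_eq_square)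
    ultimately show "(?W has_real_derivative 0) (at r)"
      using w2(2) by simp
  qed
  \<comment> \<open>At 0 the Euler derivative vanishes for two reasons: through \<open>r ^ k\<close>
    if k > 0, and through the factor \<open>r^2\<close> if k = 0, where
    \<open>0 ^ 0 = 1\<close>.\<close>
  then show ?thesis by (cases k) (auto simp: bessel_euler_def)
qed

text \<open>A vanishing Wronskian means that the quotient of \<open>w\<close> by the profile has
  derivative 0, as long as the profile has no zero; the constant is read off at the reference radius
  1/2.\<close>

lemma bessel_solution_unique:
  assumes w: "bessel_solution k s w w1"
    and nz: "\<And>r. 0 < r \<Longrightarrow> r < 1 \<Longrightarrow> clifford k (s * r\<^sup>2 / 4) \<noteq> 0"
  obtains c where "\<And>r. 0 < r \<Longrightarrow> r < 1 \<Longrightarrow> w r = c * bessel_profile k s r"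
proof
  fix r :: real assume r: "0 < r" "r < 1"
  have B: "bessel_profile k s x \<noteq> 0" if "0 < x" "x < 1" for x
    using nz[OF that] that by (simp add: bessel_profile_def)
  have D: "((\<lambda>x. w x / bessel_profile k s x) has_real_derivative 0) (at x)" if x: "0 < x" "x < 1" for x
  proof -
    have "(w has_real_derivative w1 x) (at x)"
      using w x by (simp add: bessel_solution_def)
    then have "((\<lambda>x. w x / bessel_profile k s x) has_real_derivative
        (w1 x * bessel_profile k s x - w x * (bessel_euler k s x / x)) / (bessel_profile k s x * bessel_profile k s x)) (at x)"
      using x by (intro DERIV_divide DERIV_bessel_profile B) auto
    moreover have "w1 x * bessel_profile k s x - w x * (bessel_euler k s x / x) = 0"
      using bessel_solution_wronskian[OF w x] x by (simp add: field_simps)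
    ultimately show ?thesis by simp
  qed
  have "w r / bessel_profile k s r = w (1 / 2) / bessel_profile k s (1 / 2)"
    by (rule DERIV_isconst3[of 0 1 r "1 / 2"]) (use r D in auto)
  then show "w r = w (1 / 2) / bessel_profile k s (1 / 2) * bessel_profile k s r"
    using B[OF r] by (simp add: field_simps)
qed

text \<open>\<open>J\<^sub>0\<close> changes sign on the interval of interest, so here the Wronskian is replaced by the energy
  \<open>h'\<^sup>2 - s h\<^sup>2\<close> of the difference \<open>h\<close> of two solutions, which is nonincreasing.\<close>

lemma bessel_solution_unique_0:
  assumes w: "bessel_solution 0 s w w1" and "w1 0 = 0" "s < 0" and r: "0 < r" "r < 1"
  shows "w r = w 0 * bessel_profile 0 s r"
proof -
  define h where "h r = w r - w 0 * bessel_profile 0 s r" for r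
  define h1 where "h1 r = w1 r - w 0 * (s * r / 2 * clifford 1 (s * r\<^sup>2 / 4))" for r
  define E where "E r = (h1 r)\<^sup>2 - s * (h r)\<^sup>2" for r
  have "E r \<le> E 0"
  proof (rule DERIV_nonpos_imp_decreasing_open[OF less_imp_le[OF r(1)]])
    show "continuous_on {0..r} E"
      unfolding E_def h_def h1_def bessel_profile_def
      by (intro continuous_intros continuous_on_bessel_solution[OF w r(2)]) auto
    fix x assume x: "0 < x" "x < r"
    then have "\<bar>x\<bar> < 1" using r by simp
    moreover have "(real 0)\<^sup>2 + s * x\<^sup>2 = s * x\<^sup>2" by simp
    ultimately obtain w2 where w1: "(w has_real_derivative w1 x) (at x)"
        and w2: "(w1 has_real_derivative w2) (at x)" "x\<^sup>2 * w2 + x * w1 x = s * x\<^sup>2 * w x"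
      using w unfolding bessel_solution_def by metis
    let ?t = "s * x\<^sup>2 / 4"
    define h2 where "h2 = w2 - w 0 * (s / 2 * clifford 1 ?t + s * x / 2 * (clifford (Suc 1) ?t * (s * x / 2)))"
    have d: "(h has_real_derivative h1 x) (at x)"
      unfolding h_def[abs_def] h1_def bessel_profile_def
      by (auto intro!: derivative_eq_intros w1)
    have d1: "(h1 has_real_derivative h2) (at x)"
      unfolding h1_def[abs_def] h2_def
      by (auto intro!: derivative_eq_intros w2(1) simp: algebra_simps)
    have "x * (x * h2 + h1 x) = x * (s * x * h x)"
    proof -
      have "x * (x * h2 + h1 x) = s * x\<^sup>2 * w x - w 0 * (s * x\<^sup>2 * (?t * clifford (Suc (Suc 0)) ?t + clifford (Suc 0) ?t))"
        unfolding h2_def h1_def w2(2)[symmetric] by (simp add: field_simps power2_eq_square)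
      then show ?thesis
        unfolding clifford_rec_0 h_def bessel_profile_def by (simp add: algebra_simps power2_eq_square)
    qed
    then have "x * h2 + h1 x = s * x * h x" using x by simp
    then have ode: "h2 - s * h x = - h1 x / x" using x by (simp add: field_simps)
    have "(E has_real_derivative 2 * h1 x * h2 - s * (2 * h x * h1 x)) (at x)"
      unfolding E_def[abs_def] by (auto intro!: derivative_eq_intros d d1)
    \<comment> \<open>The equation for the difference turns the last factor into
      \<open>- h1 x / x\<close>, so the derivative of the energy is
      \<open>- 2 * (h1 x)^2 / x\<close>.\<close>
    moreover have "2 * h1 x * h2 - s * (2 * h x * h1 x) = 2 * h1 x * (h2 - s * h x)"
      by (simp add: algebra_simps)
    moreover have "\<dots> \<le> 0"
      unfolding ode using x by (simp add: divide_nonneg_pos)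
    ultimately show "\<exists>y. (E has_real_derivative y) (at x) \<and> y \<le> 0" by metis
  qed
  also have "E 0 = 0" using assms(2) by (simp add: E_def h_def h1_def bessel_profile_def)
  finally have "(h1 r)\<^sup>2 + (- s) * (h r)\<^sup>2 \<le> 0" by (simp add: E_def)
  moreover have "0 \<le> (h1 r)\<^sup>2" by simp
  ultimately have "(- s) * (h r)\<^sup>2 \<le> 0" by linarith
  then have "(h r)\<^sup>2 \<le> 0" using \<open>s < 0\<close> by (simp add: mult_le_0_iff zero_le_mult_iff)
  then show ?thesis by (simp add: h_def)
qed


section \<open>Modes of clamped solutions\<close>

lemma angular_bessel_solution:
  assumes "Ck_on 2 f (ball 0 1)" "\<And>x. x \<in> ball 0 1 \<Longrightarrow> laplacian f x = s * f x"
    and "\<And>\<theta>. (T has_real_derivative T' \<theta>) (at \<theta>)" "\<And>\<theta>. (T' has_real_derivative - (real k)\<^sup>2 * T \<theta>) (at \<theta>)"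
    and "T (2 * pi) = T 0" "T' (2 * pi) = T' 0"
  shows "bessel_solution k s (angular T f) (angular_deriv T f)"
  unfolding bessel_solution_def
proof (intro allI impI conjI)
  fix r :: real assume r: "\<bar>r\<bar> < 1"
  have "continuous_on UNIV T"
    using assms(3) by (meson DERIV_continuous_on has_field_derivative_at_within)
  then show "(angular T f has_real_derivative angular_deriv T f r) (at r)"
    unfolding angular_deriv_def using Ck_on_le[OF assms(1), of 1] by (intro DERIV_angular r) auto
  show "\<exists>w2. (angular_deriv T f has_real_derivative w2) (at r) \<and>
      r\<^sup>2 * w2 + r * angular_deriv T f r = ((real k)\<^sup>2 + s * r\<^sup>2) * angular T f r"
    by (rule angular_ode[OF assms r]) blast+
qed

lemma tendsto_angular:
  assumes g: "continuous_on (cball 0 1) g" and T: "continuous_on UNIV T"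
  shows "(angular T g \<longlongrightarrow> angular T g 1) (at_left 1)"
proof -
  have "continuous_on ({0..1} \<times> cbox 0 (2 * pi)) (\<lambda>(r, \<theta>). g (r *\<^sub>R circle_pt \<theta>) * T \<theta>)"
    unfolding split_beta
    by (intro continuous_intros continuous_on_compose2[OF T] continuous_on_compose2[OF g]) auto
  from integral_continuous_on_param[OF this] have "continuous_on {0..1} (angular T g)"
    by (simp add: angular_def[abs_def])
  then have "(angular T g \<longlongrightarrow> angular T g 1) (at 1 within {0..1})"
    by (simp add: continuous_on_def)
  then show ?thesis by (simp add: at_within_Icc_at_left)
qed

text \<open>The boundary condition concerns a difference quotient along a ray, while the limits of
  coefficients involve the extended partial derivatives \<open>g\<close>. The fundamental theorem of
  calculus links them: along the ray \<open>u\<close> is the integral of the continuous function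
  \<open>G\<close>, so its one-sided derivative at the rim is \<open>G 1\<close>.\<close>

lemma clamped_radial_derivative_zero:
  assumes u: "clamped_solution \<kappa> \<mu> u"
    and g: "\<And>i. continuous_on (cball 0 1) (g i)" "\<And>i x. x \<in> ball 0 1 \<Longrightarrow> g i x = partial_deriv i u x"
  shows "cos \<theta> * g 1 (circle_pt \<theta>) + sin \<theta> * g 2 (circle_pt \<theta>) = 0"
proof -
  define G where "G t = cos \<theta> * g 1 (t *\<^sub>R circle_pt \<theta>) + sin \<theta> * g 2 (t *\<^sub>R circle_pt \<theta>)" for t
  let ?h = "\<lambda>t. u (t *\<^sub>R circle_pt \<theta>)"
  have cG: "continuous_on {0..1} G"
    unfolding G_def by (intro continuous_intros continuous_on_compose2[OF g(1)]) auto
  have "continuous_on (cball 0 1) u"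
    using u by (simp add: clamped_solution_def C1_up_to_boundary_def)
  then have ch: "continuous_on {0..1} ?h"
    by (rule continuous_on_compose2) (auto intro!: continuous_intros)
  have "Ck_on 1 u (ball 0 1)"
    using u by (simp add: clamped_solution_def C1_up_to_boundary_def)
  then have dh: "(?h has_real_derivative G t) (at t within A)" if "0 \<le> t" "t < 1" for t A
    using that DERIV_polar_radius[of u t \<theta> A] by (simp add: G_def g(2))
  have int: "integral {0..t} G = ?h t - ?h 0" if t: "t \<in> {0..1}" for t
  proof (rule integral_unique, rule fundamental_theorem_of_calculus_interior)
    show "continuous_on {0..t} ?h" by (rule continuous_on_subset[OF ch]) (use t in auto)
    show "(?h has_vector_derivative G x) (at x)" if "x \<in> {0<..<t}" for x
      using dh[of x UNIV] that t by (simp add: has_real_derivative_iff_has_vector_derivative)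
  qed (use t in auto)
  have "((\<lambda>t. integral {0..t} G) has_real_derivative G 1) (at 1 within {0..1})"
    by (rule integral_has_real_derivative[OF cG]) simp
  then have "((\<lambda>t. ?h t - ?h 0) has_real_derivative G 1) (at 1 within {0..1})"
    by (rule has_field_derivative_transform_within[OF _ zero_less_one]) (simp, rule int)
  from DERIV_add[OF this DERIV_const[of "?h 0"]]
  have "(?h has_real_derivative G 1) (at_left 1)"
    by (simp add: at_within_Icc_at_left)
  moreover have "(?h has_real_derivative 0) (at_left 1)"
    using u by (simp add: clamped_solution_def)
  ultimately have "G 1 = 0"
    unfolding has_field_derivative_iff using tendsto_unique trivial_limit_at_left_real by blast
  then show ?thesis by (simp add: G_def)
qed

lemma clamped_angular_boundary:
  assumes u: "clamped_solution \<kappa> \<mu> u" and T: "continuous_on UNIV T"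
  shows "(angular T u \<longlongrightarrow> 0) (at_left 1)" "(angular_deriv T u \<longlongrightarrow> 0) (at_left 1)"
proof -
  have c1: "C1_up_to_boundary u (ball 0 1)" and zero: "\<And>x. x \<in> sphere 0 1 \<Longrightarrow> u x = 0"
    using u by (auto simp: clamped_solution_def)
  have "angular T u 1 = 0" by (simp add: angular_def zero)
  moreover have "continuous_on (cball 0 1) u" using c1 by (simp add: C1_up_to_boundary_def)
  ultimately show "(angular T u \<longlongrightarrow> 0) (at_left 1)"
    using tendsto_angular[OF _ T] by metis
  have "\<forall>i. \<exists>g. continuous_on (cball 0 1) g \<and> (\<forall>x\<in>ball 0 1. g x = partial_deriv i u x)"
    using c1 by (simp add: C1_up_to_boundary_def)
  then obtain g where g: "\<And>i. continuous_on (cball 0 1) (g i)"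
      "\<And>i x. x \<in> ball 0 1 \<Longrightarrow> g i x = partial_deriv i u x"
    by metis
  let ?A = "\<lambda>r. angular (\<lambda>\<theta>. cos \<theta> * T \<theta>) (g 1) r + angular (\<lambda>\<theta>. sin \<theta> * T \<theta>) (g 2) r"
  have int: "((\<lambda>\<theta>. g i (circle_pt \<theta>) * F \<theta>) has_integral angular F (g i) 1) {0..2 * pi}"
    if "continuous_on UNIV F" for i F
  proof -
    have "(\<lambda>\<theta>. g i (circle_pt \<theta>) * F \<theta>) integrable_on {0..2 * pi}"
      by (intro integrable_continuous_interval continuous_intros continuous_on_compose2[OF g(1)]
          continuous_on_subset[OF that]) auto
    then show ?thesis by (simp add: angular_def integrable_integral)
  qed
  have "((\<lambda>\<theta>. g 1 (circle_pt \<theta>) * (cos \<theta> * T \<theta>) + g 2 (circle_pt \<theta>) * (sin \<theta> * T \<theta>)) has_integral ?A 1) {0..2 * pi}"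
    using T by (intro has_integral_add int continuous_intros)
  moreover have "g 1 (circle_pt \<theta>) * (cos \<theta> * T \<theta>) + g 2 (circle_pt \<theta>) * (sin \<theta> * T \<theta>) = 0" for \<theta>
  proof -
    have "(cos \<theta> * g 1 (circle_pt \<theta>) + sin \<theta> * g 2 (circle_pt \<theta>)) * T \<theta> = 0"
      using clamped_radial_derivative_zero[OF u g] by simp
    then show ?thesis by (simp add: algebra_simps)
  qed
  ultimately have "?A 1 = 0" using has_integral_unique has_integral_0 by fastforce
  moreover have "(?A \<longlongrightarrow> ?A 1) (at_left 1)"
    using T by (intro tendsto_add tendsto_angular g continuous_intros)
  ultimately have "(?A \<longlongrightarrow> 0) (at_left 1)" by simp
  moreover have "\<forall>\<^sub>F r in at_left 1. ?A r = angular_deriv T u r"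
  proof -
    have "\<forall>\<^sub>F r in at_left 1. r \<in> {0<..<1::real}"
      by (rule eventually_at_left_real) simp
    then show ?thesis
      by eventually_elim (simp add: angular_deriv_def angular_def g(2))
  qed
  ultimately show "(angular_deriv T u \<longlongrightarrow> 0) (at_left 1)"
    by (rule Lim_transform_eventually)
qed

text \<open>The operator factors as \<open>(\<Delta> + \<alpha>\<^sup>2) (\<Delta> - \<beta>\<^sup>2)\<close> with \<open>\<beta> = \<kappa> / \<alpha>\<close>; the summands are multiples of
  \<open>(\<Delta> - \<beta>\<^sup>2) u\<close> and \<open>(\<Delta> + \<alpha>\<^sup>2) u\<close>.\<close>

lemma clamped_solution_split:
  assumes u: "clamped_solution \<kappa> (\<alpha>\<^sup>2 - \<kappa>\<^sup>2 / \<alpha>\<^sup>2) u" and \<alpha>: "0 < \<alpha>"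
  obtains v p where "Ck_on 2 v (ball 0 1)" "Ck_on 2 p (ball 0 1)"
    "\<And>x. x \<in> ball 0 1 \<Longrightarrow> laplacian v x = - \<alpha>\<^sup>2 * v x"
    "\<And>x. x \<in> ball 0 1 \<Longrightarrow> laplacian p x = (\<kappa> / \<alpha>)\<^sup>2 * p x"
    "\<And>x. x \<in> ball 0 1 \<Longrightarrow> u x = v x + p x"
proof -
  let ?B = "ball 0 1 :: (real ^ 2) set"
  define b where "b = (\<kappa> / \<alpha>)\<^sup>2"
  \<comment> \<open>The functions \<open>(\<Delta> + \<alpha>^2) u\<close> and
    \<open>(\<Delta> - b) u\<close> differ by \<open>(\<alpha>^2 + b) u\<close>; \<open>k\<close>
    normalises this difference to \<open>u\<close>.\<close>
  define k where "k = 1 / (\<alpha>\<^sup>2 + b)"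
  have b: "0 \<le> b" "\<kappa>\<^sup>2 = \<alpha>\<^sup>2 * b" "\<kappa>\<^sup>2 / \<alpha>\<^sup>2 = b"
    using \<alpha> by (auto simp: b_def power_divide)
  have k: "k * (\<alpha>\<^sup>2 + b) = 1"
    using \<alpha> b(1) by (simp add: k_def add_pos_nonneg less_imp_neq[symmetric])
  have c4: "Ck_on 4 u ?B" and pde: "\<And>x. x \<in> ?B \<Longrightarrow> laplacian (laplacian u) x - \<kappa>\<^sup>2 * u x = - (\<alpha>\<^sup>2 - b) * laplacian u x"
    using u b(3) by (auto simp: clamped_solution_def)
  have cu: "Ck_on 2 u ?B" using Ck_on_le[OF c4, of 2] by simp
  have cl: "Ck_on 2 (laplacian u) ?B"
    using c4 by (intro Ck_on_laplacian) (auto simp: numeral_eq_Suc)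
  have lap: "laplacian (\<lambda>x. a * u x + c * laplacian u x) x = a * laplacian u x + c * laplacian (laplacian u) x"
    if "x \<in> ?B" for a c x
    by (rule laplacian_lincomb[OF open_ball that cu cl])
  have C: "Ck_on 2 (\<lambda>x. a * u x + c * laplacian u x) ?B" for a c
    by (intro Ck_on_add Ck_on_cmult cu cl open_ball)
  show thesis
  proof (rule that[of "\<lambda>x. k * b * u x + (- k) * laplacian u x" "\<lambda>x. k * \<alpha>\<^sup>2 * u x + k * laplacian u x", OF C C])
    fix x assume x: "x \<in> ?B"
    have p: "laplacian (laplacian u) x = \<alpha>\<^sup>2 * b * u x - (\<alpha>\<^sup>2 - b) * laplacian u x"
      using pde[OF x] b(2) by (simp add: algebra_simps)
    show "laplacian (\<lambda>x. k * b * u x + (- k) * laplacian u x) x = - \<alpha>\<^sup>2 * (k * b * u x + (- k) * laplacian u x)"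
      unfolding lap[OF x] p by (simp add: algebra_simps)
    show "laplacian (\<lambda>x. k * \<alpha>\<^sup>2 * u x + k * laplacian u x) x = (\<kappa> / \<alpha>)\<^sup>2 * (k * \<alpha>\<^sup>2 * u x + k * laplacian u x)"
      unfolding lap[OF x] p b_def[symmetric] by (simp add: algebra_simps)
    have "u x = (k * (\<alpha>\<^sup>2 + b)) * u x" unfolding k by simp
    then show "u x = (k * b * u x + (- k) * laplacian u x) + (k * \<alpha>\<^sup>2 * u x + k * laplacian u x)"
      by (simp add: algebra_simps)
  qed
qed

lemma tendsto_bessel_profile: "(bessel_profile k s \<longlongrightarrow> bessel_profile k s 1) (at_left 1)"
  and tendsto_bessel_euler: "(bessel_euler k s \<longlongrightarrow> bessel_euler k s 1) (at_left 1)"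
  unfolding bessel_profile_def[abs_def] bessel_euler_def[abs_def] by (intro tendsto_intros; simp)+

text \<open>The representation holds only for 0 < r < 1. The profiles are continuous at 1, so
  letting r tend to 1 in it and in its Euler derivative turns the two boundary conditions into two
  linear equations for \<open>c\<close> and \<open>d\<close>.\<close>

lemma clamped_mode_system:
  assumes u: "clamped_solution \<kappa> \<mu> u" and T: "continuous_on UNIV T"
    and form: "\<And>r. 0 < r \<Longrightarrow> r < 1 \<Longrightarrow> angular T u r = c * bessel_profile k s r + d * bessel_profile k t r"
  shows "c * bessel_profile k s 1 + d * bessel_profile k t 1 = 0"
    "c * bessel_euler k s 1 + d * bessel_euler k t 1 = 0"
proof -
  have ev: "\<forall>\<^sub>F r in at_left 1. r \<in> {0<..<1::real}"
    by (rule eventually_at_left_real) simp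
  have "((\<lambda>r. c * bessel_profile k s r + d * bessel_profile k t r) \<longlongrightarrow> c * bessel_profile k s 1 + d * bessel_profile k t 1) (at_left 1)"
    by (intro tendsto_intros tendsto_bessel_profile)
  moreover have "((\<lambda>r. c * bessel_profile k s r + d * bessel_profile k t r) \<longlongrightarrow> 0) (at_left 1)"
    by (rule Lim_transform_eventually[OF clamped_angular_boundary(1)[OF u T]])
       (use ev in eventually_elim, simp add: form)
  ultimately show "c * bessel_profile k s 1 + d * bessel_profile k t 1 = 0"
    using tendsto_unique trivial_limit_at_left_real by blast
  have deriv: "r * angular_deriv T u r = c * bessel_euler k s r + d * bessel_euler k t r" if r: "0 < r" "r < 1" for r
  proof -
    have "Ck_on 1 u (ball 0 1)"
      using u by (simp add: clamped_solution_def C1_up_to_boundary_def)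
    then have "(angular T u has_real_derivative angular_deriv T u r) (at r)"
      unfolding angular_deriv_def using T r by (intro DERIV_angular) auto
    moreover have "((\<lambda>r. c * bessel_profile k s r + d * bessel_profile k t r) has_real_derivative
        c * (bessel_euler k s r / r) + d * (bessel_euler k t r / r)) (at r)"
      using r by (intro DERIV_add DERIV_cmult DERIV_bessel_profile) auto
    then have "(angular T u has_real_derivative c * (bessel_euler k s r / r) + d * (bessel_euler k t r / r)) (at r)"
      by (rule has_field_derivative_transform_within_open[of _ _ _ "{0<..<1}"]) (use r form in auto)
    ultimately have "angular_deriv T u r = c * (bessel_euler k s r / r) + d * (bessel_euler k t r / r)"
      by (rule DERIV_unique)
    then show ?thesis using r by (simp add: field_simps)
  qed
  have "((\<lambda>r. c * bessel_euler k s r + d * bessel_euler k t r) \<longlongrightarrow> c * bessel_euler k s 1 + d * bessel_euler k t 1) (at_left 1)"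
    by (intro tendsto_intros tendsto_bessel_euler)
  moreover have "((\<lambda>r. c * bessel_euler k s r + d * bessel_euler k t r) \<longlongrightarrow> 0) (at_left 1)"
  proof -
    have "((\<lambda>r. r * angular_deriv T u r) \<longlongrightarrow> 1 * 0) (at_left 1)"
      by (intro tendsto_intros clamped_angular_boundary(2)[OF u T])
    then have "((\<lambda>r. r * angular_deriv T u r) \<longlongrightarrow> 0) (at_left 1)" by simp
    then show ?thesis
      by (rule Lim_transform_eventually) (use ev in eventually_elim, simp add: deriv)
  qed
  ultimately show "c * bessel_euler k s 1 + d * bessel_euler k t 1 = 0"
    using tendsto_unique trivial_limit_at_left_real by blast
qed

lemma angular_add_on_ball:
  assumes "continuous_on (ball 0 1) v" "continuous_on (ball 0 1) p" "continuous_on UNIV T" "\<bar>r\<bar> < 1"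
    and "\<And>x. x \<in> ball 0 1 \<Longrightarrow> u x = v x + p x"
  shows "angular T u r = angular T v r + angular T p r"
proof -
  have "angular T u r = angular T (\<lambda>x. 1 * v x + 1 * p x) r"
    using assms(4,5) by (simp add: angular_def)
  also have "\<dots> = 1 * angular T v r + 1 * angular T p r"
    by (rule angular_lincomb[OF assms(1-4)])
  finally show ?thesis by simp
qed

text \<open>For \<open>k \<ge> 1\<close> and \<open>\<alpha> < j\<^sub>1\<^sub>,\<^sub>1\<close> the logarithmic derivative at \<open>1\<close> of \<open>J\<^sub>k (\<alpha> r)\<close> is below \<open>k\<close> and that of
  \<open>I\<^sub>k (\<kappa> r / \<alpha>)\<close> is above \<open>k\<close>, so that the two boundary conditions are incompatible.\<close>

lemma clamped_mode_eq_0: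
  assumes u: "clamped_solution \<kappa> (\<alpha>\<^sup>2 - \<kappa>\<^sup>2 / \<alpha>\<^sup>2) u" and \<kappa>: "0 < \<kappa>" and \<alpha>: "0 < \<alpha>" "\<alpha> < bessel_J_root 1 1"
    and k: "0 < k"
    and T: "\<And>\<theta>. (T has_real_derivative T' \<theta>) (at \<theta>)" "\<And>\<theta>. (T' has_real_derivative - (real k)\<^sup>2 * T \<theta>) (at \<theta>)"
    and per: "T (2 * pi) = T 0" "T' (2 * pi) = T' 0"
    and r: "0 < r" "r < 1"
  shows "angular T u r = 0"
proof -
  obtain v p where vp: "Ck_on 2 v (ball 0 1)" "Ck_on 2 p (ball 0 1)"
    "\<And>x. x \<in> ball 0 1 \<Longrightarrow> laplacian v x = - \<alpha>\<^sup>2 * v x"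
    "\<And>x. x \<in> ball 0 1 \<Longrightarrow> laplacian p x = (\<kappa> / \<alpha>)\<^sup>2 * p x"
    "\<And>x. x \<in> ball 0 1 \<Longrightarrow> u x = v x + p x"
    by (rule clamped_solution_split[OF u \<alpha>(1)]) (rule that)
  have cT: "continuous_on UNIV T"
    using T by (meson DERIV_continuous_on has_field_derivative_at_within)
  obtain m where m: "k = Suc m" using k gr0_implies_Suc by blast
  have a1: "0 < clifford (Suc n) (- \<alpha>\<^sup>2 * r\<^sup>2 / 4)" if r: "0 \<le> r" "r \<le> 1" for n r
  proof -
    have "\<alpha> * r \<le> \<alpha>" using mult_left_le[of r \<alpha>] r \<alpha>(1) by simp
    with \<alpha>(2) have "\<alpha> * r < bessel_J_root 1 1" by linarith
    then have "(\<alpha> * r)\<^sup>2 < (bessel_J_root 1 1)\<^sup>2"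
      using r(1) \<alpha>(1) by (intro power_strict_mono) auto
    then show ?thesis
      using clifford_Suc_minus_pos[of "(\<alpha> * r)\<^sup>2 / 4" n] by (simp add: power_mult_distrib)
  qed
  have b1: "0 < clifford n ((\<kappa> / \<alpha>)\<^sup>2 * r\<^sup>2 / 4)" for n r
    by (intro clifford_pos) auto
  obtain c where c: "\<And>r. 0 < r \<Longrightarrow> r < 1 \<Longrightarrow> angular T v r = c * bessel_profile k (- \<alpha>\<^sup>2) r"
  proof (rule bessel_solution_unique[OF angular_bessel_solution[OF vp(1,3) T per]])
    show "clifford k (- \<alpha>\<^sup>2 * r\<^sup>2 / 4) \<noteq> 0" if "0 < r" "r < 1" for r
      using a1[of r m] that unfolding m by auto
  qed (assumption, rule that)
  obtain d where d: "\<And>r. 0 < r \<Longrightarrow> r < 1 \<Longrightarrow> angular T p r = d * bessel_profile k ((\<kappa> / \<alpha>)\<^sup>2) r"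
  proof (rule bessel_solution_unique[OF angular_bessel_solution[OF vp(2,4) T per]])
    show "clifford k ((\<kappa> / \<alpha>)\<^sup>2 * r\<^sup>2 / 4) \<noteq> 0" for r
      using b1[of k r] by simp
  qed (assumption, rule that)
  have form: "angular T u r = c * bessel_profile k (- \<alpha>\<^sup>2) r + d * bessel_profile k ((\<kappa> / \<alpha>)\<^sup>2) r"
    if "0 < r" "r < 1" for r
    using angular_add_on_ball[OF Ck_on_imp_continuous_on[OF vp(1)] Ck_on_imp_continuous_on[OF vp(2)] cT _ vp(5), of r]
      c[OF that] d[OF that] that by simp
  define b where "b = (\<kappa> / \<alpha>)\<^sup>2"
  define X X' Y Y' where "X = clifford k (- \<alpha>\<^sup>2 / 4)" and "X' = clifford (Suc k) (- \<alpha>\<^sup>2 / 4)"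
    and "Y = clifford k (b / 4)" and "Y' = clifford (Suc k) (b / 4)"
  have pos: "0 < X" "0 < X'" "0 < Y" "0 < Y'" "0 < b"
    using a1[of 1 m] a1[of 1 "Suc m"] b1[of k 1] b1[of "Suc k" 1] \<kappa> \<alpha>
    by (auto simp: X_def X'_def Y_def Y'_def b_def m)
  note S = clamped_mode_system[OF u cT form]
  have 1: "c * X + d * Y = 0"
    using S(1) by (simp add: bessel_profile_def X_def Y_def b_def)
  have "c * (k * X - \<alpha>\<^sup>2 / 2 * X') + d * (k * Y + b / 2 * Y') = 0"
    using S(2) by (simp add: bessel_euler_def X_def Y_def X'_def Y'_def b_def)
  \<comment> \<open>Subtracting \<open>k\<close> times the first equation leaves the excess of each
    logarithmic derivative over \<open>k\<close>: negative for the J-part, positive for the I-part.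
    Eliminating \<open>d\<close> then gives \<open>c\<close> times a positive number.\<close>
  moreover have "c * (k * X - \<alpha>\<^sup>2 / 2 * X') + d * (k * Y + b / 2 * Y')
      = k * (c * X + d * Y) + (d * (b * Y') - c * (\<alpha>\<^sup>2 * X')) / 2"
    by (simp add: field_simps)
  ultimately have "d * (b * Y') = c * (\<alpha>\<^sup>2 * X')"
    unfolding 1 by simp
  then have "c * (\<alpha>\<^sup>2 * X') * Y = (d * Y) * (b * Y')"
    by (metis mult.assoc mult.commute)
  also have "d * Y = - c * X" using 1 by simp
  finally have "c * (\<alpha>\<^sup>2 * X' * Y + X * (b * Y')) = 0"
    by (simp add: algebra_simps)
  moreover have "0 < \<alpha>\<^sup>2 * X' * Y + X * (b * Y')"
    using pos \<alpha> by (intro add_pos_pos mult_pos_pos) auto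
  ultimately have "c = 0" by simp
  with 1 pos have "d = 0" by simp
  with \<open>c = 0\<close> form[OF r] show ?thesis by simp
qed

text \<open>At radius 0 the partial derivatives are constant in the angle, and cosine and sine have
  mean 0. This supplies the initial condition for the energy argument.\<close>

lemma angular_deriv_const_at_0: "angular_deriv (\<lambda>_. 1) f 0 = 0"
  unfolding angular_deriv_def angular_def
  using has_integral_cos_0[of 1] has_integral_sin_0[of 1]
  by (simp add: integral_unique)

lemma clamped_mode_0:
  assumes u: "clamped_solution \<kappa> (\<alpha>\<^sup>2 - \<kappa>\<^sup>2 / \<alpha>\<^sup>2) u" and \<alpha>: "0 < \<alpha>"
  obtains c d where
    "\<And>r. 0 < r \<Longrightarrow> r < 1 \<Longrightarrow> angular (\<lambda>_. 1) u r = c * bessel_profile 0 (- \<alpha>\<^sup>2) r + d * bessel_profile 0 ((\<kappa> / \<alpha>)\<^sup>2) r"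
proof -
  obtain v p where vp: "Ck_on 2 v (ball 0 1)" "Ck_on 2 p (ball 0 1)"
    "\<And>x. x \<in> ball 0 1 \<Longrightarrow> laplacian v x = - \<alpha>\<^sup>2 * v x"
    "\<And>x. x \<in> ball 0 1 \<Longrightarrow> laplacian p x = (\<kappa> / \<alpha>)\<^sup>2 * p x"
    "\<And>x. x \<in> ball 0 1 \<Longrightarrow> u x = v x + p x"
    by (rule clamped_solution_split[OF u \<alpha>]) (rule that)
  have T: "((\<lambda>_. 1) has_real_derivative 0) (at \<theta>)" "((\<lambda>_. 0) has_real_derivative - (real 0)\<^sup>2 * 1) (at \<theta>)" for \<theta> :: real
    by auto
  note sol = angular_bessel_solution[where T = "\<lambda>_. 1" and T' = "\<lambda>_. 0" and k = 0, OF _ _ T refl refl]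
  \<comment> \<open>The oscillating part needs the energy argument since J_0 may vanish; I_0 has no
    zero, so the quotient argument serves for \<open>p\<close>.\<close>
  have c: "angular (\<lambda>_. 1) v r = angular (\<lambda>_. 1) v 0 * bessel_profile 0 (- \<alpha>\<^sup>2) r" if "0 < r" "r < 1" for r
    using \<alpha> by (intro bessel_solution_unique_0[OF sol[OF vp(1,3)] angular_deriv_const_at_0 _ that]) auto
  obtain d where d: "\<And>r. 0 < r \<Longrightarrow> r < 1 \<Longrightarrow> angular (\<lambda>_. 1) p r = d * bessel_profile 0 ((\<kappa> / \<alpha>)\<^sup>2) r"
  proof (rule bessel_solution_unique[OF sol[OF vp(2,4)]])
    show "clifford 0 ((\<kappa> / \<alpha>)\<^sup>2 * r\<^sup>2 / 4) \<noteq> 0" for r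
      using clifford_pos[of "(\<kappa> / \<alpha>)\<^sup>2 * r\<^sup>2 / 4" 0] by simp
  qed (assumption, rule that)
  have form: "angular (\<lambda>_. 1) u r = angular (\<lambda>_. 1) v 0 * bessel_profile 0 (- \<alpha>\<^sup>2) r + d * bessel_profile 0 ((\<kappa> / \<alpha>)\<^sup>2) r"
    if "0 < r" "r < 1" for r
    using angular_add_on_ball[OF Ck_on_imp_continuous_on[OF vp(1)] Ck_on_imp_continuous_on[OF vp(2)] continuous_on_const _ vp(5), of r]
      c[OF that] d[OF that] that by simp
  then show thesis by (rule that)
qed


section \<open>The first eigenvalue\<close>

lemma bessel_J_0_eq_profile: "bessel_J 0 (\<alpha> * r) = bessel_profile 0 (- \<alpha>\<^sup>2) r"
  by (simp add: bessel_J_eq_clifford bessel_profile_def power_mult_distrib)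

lemma bessel_I_0_eq_profile: "bessel_I 0 (\<beta> * r) = bessel_profile 0 (\<beta>\<^sup>2) r"
  by (simp add: bessel_I_eq_clifford bessel_profile_def power_mult_distrib)

section \<open>The boundary system, its determinant and radial eigenfunctions\<close>

lemma boundary_system_iff:
  "boundary_system \<kappa> \<alpha> c d \<longleftrightarrow>
     c * bessel_profile 0 (- \<alpha>\<^sup>2) 1 + d * bessel_profile 0 ((\<kappa> / \<alpha>)\<^sup>2) 1 = 0 \<and>
     c * bessel_euler 0 (- \<alpha>\<^sup>2) 1 + d * bessel_euler 0 ((\<kappa> / \<alpha>)\<^sup>2) 1 = 0"
  unfolding boundary_system_def deriv_bessel_J_0 deriv_bessel_I_0 bessel_J_eq_clifford bessel_I_eq_clifford
    bessel_profile_def bessel_euler_def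
  by (simp add: power2_eq_square mult.assoc)

abbreviation (input) mode_0 :: "real \<Rightarrow> real \<Rightarrow> real \<Rightarrow> real \<Rightarrow> real \<Rightarrow> real" where
  "mode_0 \<kappa> \<alpha> c d r \<equiv> c * bessel_J 0 (\<alpha> * r) + d * bessel_I 0 (\<kappa> / \<alpha> * r)"

text \<open>\<open>F0\<close> is the determinant of the boundary system. By Cramer's rule its
  products with \<open>c\<close> and with \<open>d\<close> are combinations of the two equations,
  hence 0.\<close>

lemma F0_eq_0_if_boundary_system:
  assumes "boundary_system \<kappa> \<alpha> c d" "(c, d) \<noteq> (0, 0)"
  shows "F0 \<kappa> \<alpha> = 0"
proof -
  let ?J = "bessel_J 0 \<alpha>" and ?I = "bessel_I 0 (\<kappa> / \<alpha>)"
  let ?J' = "\<alpha> * deriv (bessel_J 0) \<alpha>" and ?I' = "(\<kappa> / \<alpha>) * deriv (bessel_I 0) (\<kappa> / \<alpha>)"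
  have 1: "c * ?J + d * ?I = 0" and 2: "c * ?J' + d * ?I' = 0"
    using assms(1) by (simp_all add: boundary_system_def mult.assoc)
  have F: "F0 \<kappa> \<alpha> = ?J * ?I' - ?I * ?J'" by (simp add: F0_def algebra_simps)
  have "c * F0 \<kappa> \<alpha> = (c * ?J + d * ?I) * ?I' - ?I * (c * ?J' + d * ?I')"
    unfolding F by (simp only: algebra_simps)
  then have "c * F0 \<kappa> \<alpha> = 0" unfolding 1 2 by simp
  moreover have "d * F0 \<kappa> \<alpha> = ?J * (c * ?J' + d * ?I') - (c * ?J + d * ?I) * ?J'"
    unfolding F by (simp only: algebra_simps)
  then have "d * F0 \<kappa> \<alpha> = 0" unfolding 1 2 by simp
  ultimately show ?thesis using assms(2) by auto
qed

lemma boundary_system_solvable: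
  assumes "F0 \<kappa> \<alpha> = 0" "bessel_I 0 (\<kappa> / \<alpha>) \<noteq> 0"
  shows "boundary_system \<kappa> \<alpha> (- bessel_I 0 (\<kappa> / \<alpha>)) (bessel_J 0 \<alpha>)"
  using assms by (simp add: boundary_system_def F0_def algebra_simps)

text \<open>On a circle of radius 0 < r < 1 all modes k \<ge> 1 vanish, so \<open>u\<close> is
  constant there and equals its mean, which mode 0 determines. The centre follows by continuity, the
  rim from the first boundary equation.\<close>

lemma clamped_solution_radial:
  assumes u: "clamped_solution \<kappa> (\<alpha>\<^sup>2 - \<kappa>\<^sup>2 / \<alpha>\<^sup>2) u" and \<kappa>: "0 < \<kappa>" and \<alpha>: "0 < \<alpha>" "\<alpha> < bessel_J_root 1 1"
  obtains c d where "boundary_system \<kappa> \<alpha> c d" "\<And>x. x \<in> cball 0 1 \<Longrightarrow> u x = mode_0 \<kappa> \<alpha> c d (norm x)"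
proof -
  obtain c d where form: "\<And>r. 0 < r \<Longrightarrow> r < 1 \<Longrightarrow>
      angular (\<lambda>_. 1) u r = c * bessel_profile 0 (- \<alpha>\<^sup>2) r + d * bessel_profile 0 ((\<kappa> / \<alpha>)\<^sup>2) r"
    by (rule clamped_mode_0[OF u \<alpha>(1)]) (rule that)
  have "boundary_system \<kappa> \<alpha> c d"
    unfolding boundary_system_iff using clamped_mode_system[OF u continuous_on_const form] by simp
  \<comment> \<open>Division by \<open>2 * pi\<close> turns the unnormalised coefficient into the
    mean; the system is homogeneous and survives it.\<close>
  then have bs: "boundary_system \<kappa> \<alpha> (c / (2 * pi)) (d / (2 * pi))"
    unfolding boundary_system_def by (simp add: field_simps)
  let ?R = "mode_0 \<kappa> \<alpha> (c / (2 * pi)) (d / (2 * pi))"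
  have c1: "C1_up_to_boundary u (ball 0 1)" using u by (simp add: clamped_solution_def)
  have cu: "continuous_on (cball 0 1) u" using c1 by (simp add: C1_up_to_boundary_def)
  have zero: "angular (\<lambda>\<theta>. cos (real k * \<theta>)) u r = 0" "angular (\<lambda>\<theta>. sin (real k * \<theta>)) u r = 0"
    if k: "0 < k" and r: "0 < r" "r < 1" for k :: nat and r
  proof -
    have per: "cos (real k * (2 * pi)) = cos (real k * 0)" "sin (real k * (2 * pi)) = sin (real k * 0)"
      using cos_int_2pin[of "int k"] sin_int_2pin[of "int k"] by (simp_all add: mult_ac)
    show "angular (\<lambda>\<theta>. cos (real k * \<theta>)) u r = 0"
    proof (rule clamped_mode_eq_0[OF u \<kappa> \<alpha> k _ _ _ _ r, where T' = "\<lambda>\<theta>. - real k * sin (real k * \<theta>)"])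
      show "((\<lambda>\<theta>. cos (real k * \<theta>)) has_real_derivative - real k * sin (real k * \<theta>)) (at \<theta>)" for \<theta>
        by (auto intro!: derivative_eq_intros)
      show "((\<lambda>\<theta>. - real k * sin (real k * \<theta>)) has_real_derivative - (real k)\<^sup>2 * cos (real k * \<theta>)) (at \<theta>)" for \<theta>
        by (auto intro!: derivative_eq_intros simp: power2_eq_square)
    qed (simp_all only: per)
    show "angular (\<lambda>\<theta>. sin (real k * \<theta>)) u r = 0"
    proof (rule clamped_mode_eq_0[OF u \<kappa> \<alpha> k _ _ _ _ r, where T' = "\<lambda>\<theta>. real k * cos (real k * \<theta>)"])
      show "((\<lambda>\<theta>. sin (real k * \<theta>)) has_real_derivative real k * cos (real k * \<theta>)) (at \<theta>)" for \<theta>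
        by (auto intro!: derivative_eq_intros)
      show "((\<lambda>\<theta>. real k * cos (real k * \<theta>)) has_real_derivative - (real k)\<^sup>2 * sin (real k * \<theta>)) (at \<theta>)" for \<theta>
        by (auto intro!: derivative_eq_intros simp: power2_eq_square)
    qed (simp_all only: per)
  qed
  have inside: "u x = ?R (norm x)" if x: "x \<in> ball 0 1" "x \<noteq> 0" for x
  proof -
    obtain r \<theta> where r: "0 \<le> r" and xr: "x = r *\<^sub>R circle_pt \<theta>"
      by (rule circle_pt_exhaust)
    have n: "norm x = r" using r by (simp add: xr)
    then have r01: "0 < r" "r < 1" using x by auto
    have "continuous_on (sphere 0 1) (\<lambda>y. u (r *\<^sub>R y))"
      using r01 by (intro continuous_on_compose2[OF cu] continuous_intros) auto
    then have "u (r *\<^sub>R circle_pt \<theta>) = integral {0..2 * pi} (\<lambda>\<theta>. u (r *\<^sub>R circle_pt \<theta>)) / (2 * pi)"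
      using zero[OF _ r01] unfolding angular_def by (intro fourier_coefficients_zero_imp_const)
    also have "integral {0..2 * pi} (\<lambda>\<theta>. u (r *\<^sub>R circle_pt \<theta>)) = angular (\<lambda>_. 1) u r"
      by (simp add: angular_def)
    also have "angular (\<lambda>_. 1) u r / (2 * pi) = ?R r"
      unfolding form[OF r01] bessel_J_0_eq_profile bessel_I_0_eq_profile by (simp add: add_divide_distrib)
    finally show ?thesis unfolding n by (simp add: xr)
  qed
  have center: "u 0 = ?R (norm (0 :: real ^ 2))"
  proof -
    have "continuous_on (ball 0 1) (\<lambda>x. u x - ?R (norm x))"
      unfolding bessel_J_0_eq_profile bessel_I_0_eq_profile bessel_profile_def
      by (intro continuous_intros continuous_on_subset[OF cu]) auto
    then have "isCont (\<lambda>x. u x - ?R (norm x)) 0"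
      by (simp add: continuous_on_eq_continuous_at)
    then have "((\<lambda>x. u x - ?R (norm x)) \<longlongrightarrow> u 0 - ?R (norm (0 :: real ^ 2))) (at 0)"
      by (simp only: isCont_def)
    moreover have "((\<lambda>x. u x - ?R (norm x)) \<longlongrightarrow> 0) (at 0)"
    proof (rule tendsto_eventually)
      show "\<forall>\<^sub>F x in at 0. u x - ?R (norm x) = 0"
        unfolding eventually_at_topological
        by (rule exI[of _ "ball 0 1"]) (use inside in auto)
    qed
    ultimately have "u 0 - ?R (norm (0 :: real ^ 2)) = 0"
      using LIM_unique by blast
    then show ?thesis by (rule eq_iff_diff_eq_0[THEN iffD2])
  qed
  have rim: "u x = ?R (norm x)" if "x \<in> sphere 0 1" for x
    using u bs that by (simp add: clamped_solution_def boundary_system_def)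
  have "u x = ?R (norm x)" if "x \<in> cball 0 1" for x
  proof (cases "x = 0")
    case False
    then show ?thesis using inside[of x] rim[of x] that by (cases "norm x = 1") auto
  qed (simp only: center)
  then show thesis by (rule that[OF bs])
qed

lemma radial_in_eigenspace:
  assumes bs: "boundary_system \<kappa> \<alpha> c d" and \<alpha>: "0 < \<alpha>"
  shows "radial_on_disc (mode_0 \<kappa> \<alpha> c d) \<in> eigenspace \<kappa> (\<alpha>\<^sup>2 - \<kappa>\<^sup>2 / \<alpha>\<^sup>2)"
proof -
  let ?B = "ball 0 1 :: (real ^ 2) set"
  define b where "b = (\<kappa> / \<alpha>)\<^sup>2"
  define H where "H s x = clifford 0 (s * (norm x)\<^sup>2 / 4)" for s and x :: "real ^ 2"
  \<comment> \<open>\<open>U\<close> extends the radial function smoothly to the whole plane, so its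
    own partial derivatives are the continuous extensions to the closed disc.\<close>
  define U where "U x = c * H (- \<alpha>\<^sup>2) x + d * H b x" for x
  define u where "u = radial_on_disc (mode_0 \<kappa> \<alpha> c d)"
  have b: "\<kappa>\<^sup>2 = \<alpha>\<^sup>2 * b" "\<kappa>\<^sup>2 / \<alpha>\<^sup>2 = b"
    using \<alpha> by (auto simp: b_def power_divide)
  have uU: "u x = U x" if "x \<in> cball 0 1" for x
    unfolding u_def radial_on_disc_def U_def H_def bessel_J_0_eq_profile bessel_I_0_eq_profile
      bessel_profile_def b_def using that by simp
  then have uB: "u x = U x" if "x \<in> ?B" for x using that by simp
  have H: "Ck_on n (H s) UNIV" for n s
    unfolding H_def by (rule Ck_on_clifford_norm) simp
  have lapH: "laplacian (H s) x = s * H s x" for s x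
    unfolding H_def[abs_def] by (rule laplacian_clifford_norm)
  have comb: "Ck_on n (\<lambda>x. p * H (- \<alpha>\<^sup>2) x + q * H b x) UNIV" for n p q
    by (intro Ck_on_add Ck_on_cmult H open_UNIV)
  have lap: "laplacian (\<lambda>x. p * H (- \<alpha>\<^sup>2) x + q * H b x) = (\<lambda>x. (p * - \<alpha>\<^sup>2) * H (- \<alpha>\<^sup>2) x + (q * b) * H b x)" for p q
    by (rule ext) (simp add: laplacian_lincomb[OF open_UNIV UNIV_I H H] lapH)
  have U: "Ck_on n U UNIV" for n unfolding U_def by (rule comb)
  have restrict: "Ck_on n U ?B" for n
  proof -
    have "Ck_on n f UNIV \<Longrightarrow> Ck_on n f S" for f :: "real ^ 2 \<Rightarrow> real" and S
      by (induction n arbitrary: f) (auto intro: continuous_on_subset)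
    then show ?thesis using U by blast
  qed
  have Cu: "Ck_on n u ?B" for n
    using Ck_on_cong[of ?B u U n, OF open_ball uB] restrict by blast
  have "C1_up_to_boundary u ?B"
    unfolding C1_up_to_boundary_def
  proof (intro conjI allI)
    show "continuous_on (closure ?B) u"
    proof -
      have "continuous_on (cball 0 1) U"
        by (rule continuous_on_subset[OF Ck_on_imp_continuous_on[OF U[of 0]] subset_UNIV])
      then have "continuous_on (cball 0 1) u"
        by (subst continuous_on_cong[OF refl uU])
      then show ?thesis by simp
    qed
    fix i :: 2
    have "continuous_on UNIV (partial_deriv i U)"
      using U[of 1] by simp
    then have "continuous_on (closure ?B) (partial_deriv i U)"
      by (rule continuous_on_subset) simp
    moreover have "partial_deriv i U x = partial_deriv i u x" if "x \<in> ?B" for x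
      by (rule partial_deriv_cong[OF open_ball that, symmetric]) (rule uB)
    ultimately show "\<exists>g. continuous_on (closure ?B) g \<and> (\<forall>x\<in>?B. g x = partial_deriv i u x)"
      by blast
  qed (rule Cu)
  moreover have "laplacian (laplacian u) x - \<kappa>\<^sup>2 * u x = - (\<alpha>\<^sup>2 - b) * laplacian u x" if x: "x \<in> ?B" for x
  proof -
    have 1: "laplacian u y = laplacian U y" if "y \<in> ?B" for y
      by (rule laplacian_cong[OF open_ball that uB])
    have "laplacian (laplacian u) x = laplacian (laplacian U) x"
      by (rule laplacian_cong[OF open_ball x 1])
    then show ?thesis
      unfolding 1[OF x] uB[OF x] U_def[abs_def] lap b(1) by (simp add: algebra_simps)
  qed
  moreover have "u x = 0 \<and> ((\<lambda>t. u (t *\<^sub>R x)) has_real_derivative 0) (at_left 1)" if x: "x \<in> sphere 0 1" for x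
  proof
    let ?R = "\<lambda>r. c * bessel_profile 0 (- \<alpha>\<^sup>2) r + d * bessel_profile 0 b r"
    have uR: "u (t *\<^sub>R x) = ?R t" if "0 < t" "t \<le> 1" for t
      using uU[of "t *\<^sub>R x"] x that by (simp add: U_def H_def bessel_profile_def)
    have sys: "?R 1 = 0" "c * bessel_euler 0 (- \<alpha>\<^sup>2) 1 + d * bessel_euler 0 b 1 = 0"
      using bs by (simp_all add: boundary_system_iff b_def)
    show "u x = 0" using uR[of 1] sys(1) by simp
    have "(?R has_real_derivative c * (bessel_euler 0 (- \<alpha>\<^sup>2) 1 / 1) + d * (bessel_euler 0 b 1 / 1)) (at 1)"
      by (intro DERIV_add DERIV_cmult DERIV_bessel_profile) auto
    then have "(?R has_real_derivative 0) (at_left 1)"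
      using sys(2) by (simp add: has_field_derivative_at_within)
    moreover have "\<forall>\<^sub>F t in at_left 1. t \<in> {0<..<1::real}"
      by (rule eventually_at_left_real) simp
    then have "\<forall>\<^sub>F t in at_left 1. u (t *\<^sub>R x) = ?R t"
      by eventually_elim (simp add: uR)
    then have "((\<lambda>t. u (t *\<^sub>R x)) has_real_derivative 0) (at_left 1) \<longleftrightarrow> (?R has_real_derivative 0) (at_left 1)"
      by (rule has_field_derivative_cong_eventually) (use uR[of 1] in simp)
    ultimately show "((\<lambda>t. u (t *\<^sub>R x)) has_real_derivative 0) (at_left 1)" by blast
  qed
  ultimately have "clamped_solution \<kappa> (\<alpha>\<^sup>2 - \<kappa>\<^sup>2 / \<alpha>\<^sup>2) u"
    using Cu unfolding clamped_solution_def b(2) by blast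
  then show ?thesis
    by (simp add: eigenspace_def u_def radial_on_disc_def)
qed

lemma eigenspace_radial:
  assumes "0 < \<kappa>" "0 < \<alpha>" "\<alpha> < bessel_J_root 1 1"
  shows "eigenspace \<kappa> (\<alpha>\<^sup>2 - \<kappa>\<^sup>2 / \<alpha>\<^sup>2) = {radial_on_disc (mode_0 \<kappa> \<alpha> c d) | c d. boundary_system \<kappa> \<alpha> c d}"
proof (intro equalityI subsetI)
  fix u assume "u \<in> eigenspace \<kappa> (\<alpha>\<^sup>2 - \<kappa>\<^sup>2 / \<alpha>\<^sup>2)"
  then have u: "clamped_solution \<kappa> (\<alpha>\<^sup>2 - \<kappa>\<^sup>2 / \<alpha>\<^sup>2) u" "\<And>x. x \<notin> cball 0 1 \<Longrightarrow> u x = 0"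
    by (auto simp: eigenspace_def)
  obtain c d where cd: "boundary_system \<kappa> \<alpha> c d" "\<And>x. x \<in> cball 0 1 \<Longrightarrow> u x = mode_0 \<kappa> \<alpha> c d (norm x)"
    by (rule clamped_solution_radial[OF u(1) assms]) (rule that)
  then have "u = radial_on_disc (mode_0 \<kappa> \<alpha> c d)"
    using u(2) by (auto simp: radial_on_disc_def fun_eq_iff simp del: mem_cball)
  with cd(1) show "u \<in> {radial_on_disc (mode_0 \<kappa> \<alpha> c d) | c d. boundary_system \<kappa> \<alpha> c d}" by blast
qed (use radial_in_eigenspace assms in blast)

section \<open>Comparison of eigenvalues and simplicity of the first one\<close>

lemma exists_frequency:
  assumes "0 < \<kappa>"
  obtains \<alpha> :: real where "0 < \<alpha>" "\<mu> = \<alpha>\<^sup>2 - \<kappa>\<^sup>2 / \<alpha>\<^sup>2"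
proof -
  \<comment> \<open>The positive root of \<open>t^2 - \<mu> t - \<kappa>^2\<close>, to be used as
    \<open>\<alpha>^2\<close>.\<close>
  define t where "t = (\<mu> + sqrt (\<mu>\<^sup>2 + 4 * \<kappa>\<^sup>2)) / 2"
  have "\<bar>\<mu>\<bar> < sqrt (\<mu>\<^sup>2 + 4 * \<kappa>\<^sup>2)"
    using assms by (intro real_less_rsqrt) simp
  then have "0 < t" by (simp add: t_def)
  have "sqrt (\<mu>\<^sup>2 + 4 * \<kappa>\<^sup>2) = 2 * t - \<mu>" by (simp add: t_def field_simps)
  then have "(2 * t - \<mu>)\<^sup>2 = \<mu>\<^sup>2 + 4 * \<kappa>\<^sup>2"
    by (metis add_nonneg_nonneg mult_nonneg_nonneg real_sqrt_pow2 zero_le_numeral zero_le_power2)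
  then have "t * t = \<mu> * t + \<kappa>\<^sup>2" by (simp add: power2_eq_square algebra_simps)
  then have "\<mu> = t - \<kappa>\<^sup>2 / t" using \<open>0 < t\<close> by (simp add: field_simps)
  then show thesis using that[of "sqrt t"] \<open>0 < t\<close> by simp
qed

lemma frequency_le:
  assumes "0 < \<alpha>" "0 < \<beta>" "\<alpha>\<^sup>2 - \<kappa>\<^sup>2 / \<alpha>\<^sup>2 < \<beta>\<^sup>2 - \<kappa>\<^sup>2 / \<beta>\<^sup>2"
  shows "\<alpha> < (\<beta>::real)"
proof (rule ccontr)
  assume "\<not> \<alpha> < \<beta>"
  then have 1: "\<beta>\<^sup>2 \<le> \<alpha>\<^sup>2" using assms(2) by (intro power_mono) auto
  then have "\<kappa>\<^sup>2 / \<alpha>\<^sup>2 \<le> \<kappa>\<^sup>2 / \<beta>\<^sup>2" using assms by (intro divide_left_mono) auto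
  with 1 assms(3) show False by simp
qed

context
  fixes \<kappa> :: real
  assumes \<kappa>: "0 < \<kappa>"
begin

lemma bessel_I_pos: "0 < bessel_I 0 x"
  unfolding bessel_I_eq_clifford by (simp add: clifford_pos)

lemma bessel_J_0_alpha01: "bessel_J 0 (alpha01 \<kappa>) < 0"
  using clifford_0_alpha01[OF \<kappa>] by (simp add: bessel_J_eq_clifford)

text \<open>At the origin J_0 and I_0 are both 1, so a vanishing function has
  \<open>d = - c\<close>. The first boundary equation then gives \<open>c = 0\<close>, as J_0 is
  negative and I_0 positive at their arguments.\<close>

lemma radial_eq_0_iff:
  assumes "boundary_system \<kappa> (alpha01 \<kappa>) c d"
  shows "(\<forall>x. radial_on_disc (mode_0 \<kappa> (alpha01 \<kappa>) c d) x = 0) \<longleftrightarrow> (c, d) = (0, 0)"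
proof
  assume "\<forall>x. radial_on_disc (mode_0 \<kappa> (alpha01 \<kappa>) c d) x = 0"
  then have "radial_on_disc (mode_0 \<kappa> (alpha01 \<kappa>) c d) 0 = 0" ..
  then have "d = - c"
    by (simp add: radial_on_disc_def bessel_J_eq_clifford bessel_I_eq_clifford)
  with assms have "c * (bessel_J 0 (alpha01 \<kappa>) - bessel_I 0 (\<kappa> / alpha01 \<kappa>)) = 0"
    by (simp add: boundary_system_def algebra_simps)
  with bessel_J_0_alpha01 bessel_I_pos[of "\<kappa> / alpha01 \<kappa>"] \<open>d = - c\<close> show "(c, d) = (0, 0)" by auto
qed (simp add: radial_on_disc_def)

lemma eigenfunctions_alpha01:
  "{u. eigenfunction \<kappa> ((alpha01 \<kappa>)\<^sup>2 - \<kappa>\<^sup>2 / (alpha01 \<kappa>)\<^sup>2) u} =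
     {radial_on_disc (mode_0 \<kappa> (alpha01 \<kappa>) c d) | c d. (c, d) \<noteq> (0, 0) \<and> boundary_system \<kappa> (alpha01 \<kappa>) c d}"
  unfolding eigenfunction_def eigenspace_radial[OF \<kappa> alpha01_pos[OF \<kappa>] alpha01_less[OF \<kappa>]]
  using radial_eq_0_iff by blast

lemma boundary_system_alpha01:
  "boundary_system \<kappa> (alpha01 \<kappa>) (- bessel_I 0 (\<kappa> / alpha01 \<kappa>)) (bessel_J 0 (alpha01 \<kappa>))"
  using boundary_system_solvable[OF F0_alpha01[OF \<kappa>]] bessel_I_pos[of "\<kappa> / alpha01 \<kappa>"] by simp

lemma eigenvalue_alpha01: "eigenvalue \<kappa> ((alpha01 \<kappa>)\<^sup>2 - \<kappa>\<^sup>2 / (alpha01 \<kappa>)\<^sup>2)"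
proof -
  have "radial_on_disc (mode_0 \<kappa> (alpha01 \<kappa>) (- bessel_I 0 (\<kappa> / alpha01 \<kappa>)) (bessel_J 0 (alpha01 \<kappa>)))
      \<in> {u. eigenfunction \<kappa> ((alpha01 \<kappa>)\<^sup>2 - \<kappa>\<^sup>2 / (alpha01 \<kappa>)\<^sup>2) u}"
    unfolding eigenfunctions_alpha01 mem_Collect_eq
    by (intro exI conjI, rule refl) (use boundary_system_alpha01 bessel_J_0_alpha01 in auto)
  then show ?thesis unfolding eigenvalue_def by blast
qed

text \<open>A smaller \<mu> would have its \<alpha> below \<open>alpha01 \<kappa>\<close>, hence
  below \<open>j_{1,1}\<close>: its eigenfunctions would be radial, but the determinant
  \<open>F0\<close> is positive there and leaves only the zero solution.\<close>

lemma eigenvalue_ge: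
  assumes "eigenvalue \<kappa> \<mu>"
  shows "(alpha01 \<kappa>)\<^sup>2 - \<kappa>\<^sup>2 / (alpha01 \<kappa>)\<^sup>2 \<le> \<mu>"
proof (rule ccontr)
  assume less: "\<not> (alpha01 \<kappa>)\<^sup>2 - \<kappa>\<^sup>2 / (alpha01 \<kappa>)\<^sup>2 \<le> \<mu>"
  obtain \<alpha> where \<alpha>: "0 < \<alpha>" "\<mu> = \<alpha>\<^sup>2 - \<kappa>\<^sup>2 / \<alpha>\<^sup>2"
    by (rule exists_frequency[OF \<kappa>])
  have "\<alpha> < alpha01 \<kappa>"
    using frequency_le[OF \<alpha>(1) alpha01_pos[OF \<kappa>], of \<kappa>] less \<alpha>(2) by simp
  then have "\<alpha> < bessel_J_root 1 1" "0 < F0 \<kappa> \<alpha>"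
    using alpha01_less[OF \<kappa>] F0_pos[OF \<kappa> \<alpha>(1)] by (simp_all only: less_trans)
  have "u x = 0" if u: "u \<in> eigenspace \<kappa> \<mu>" for u x
  proof -
    obtain c d where cd: "u = radial_on_disc (mode_0 \<kappa> \<alpha> c d)" "boundary_system \<kappa> \<alpha> c d"
      using u unfolding \<alpha>(2) eigenspace_radial[OF \<kappa> \<alpha>(1) \<open>\<alpha> < bessel_J_root 1 1\<close>] by blast
    have "(c, d) = (0, 0)"
      using F0_eq_0_if_boundary_system[OF cd(2)] \<open>0 < F0 \<kappa> \<alpha>\<close> by fastforce
    then show ?thesis by (simp add: cd(1) radial_on_disc_def)
  qed
  with assms show False by (auto simp: eigenvalue_def eigenfunction_def)
qed

lemma first_eigenvalue_eq: "first_eigenvalue \<kappa> = (alpha01 \<kappa>)\<^sup>2 - \<kappa>\<^sup>2 / (alpha01 \<kappa>)\<^sup>2"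
  unfolding first_eigenvalue_def
  by (rule Least_equality) (use eigenvalue_alpha01 eigenvalue_ge in auto)

lemma simple_first_eigenvalue: "simple_eigenvalue \<kappa> (first_eigenvalue \<kappa>)"
proof -
  let ?I = "bessel_I 0 (\<kappa> / alpha01 \<kappa>)" and ?J = "bessel_J 0 (alpha01 \<kappa>)"
  define e where "e = radial_on_disc (mode_0 \<kappa> (alpha01 \<kappa>) (- ?I) ?J)"
  have bs: "boundary_system \<kappa> (alpha01 \<kappa>) (- ?I) ?J" by (rule boundary_system_alpha01)
  have I: "?I \<noteq> 0" using bessel_I_pos[of "\<kappa> / alpha01 \<kappa>"] by simp
  have "eigenspace \<kappa> (first_eigenvalue \<kappa>) = range (\<lambda>t x. t * e x)"
    unfolding first_eigenvalue_eq eigenspace_radial[OF \<kappa> alpha01_pos[OF \<kappa>] alpha01_less[OF \<kappa>]]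
  proof (intro equalityI subsetI)
    fix u assume "u \<in> {radial_on_disc (mode_0 \<kappa> (alpha01 \<kappa>) c d) | c d. boundary_system \<kappa> (alpha01 \<kappa>) c d}"
    then obtain c d where u: "u = radial_on_disc (mode_0 \<kappa> (alpha01 \<kappa>) c d)" and cd: "boundary_system \<kappa> (alpha01 \<kappa>) c d"
      by blast
    \<comment> \<open>Matches the first component; the first boundary equation then fixes the
      second.\<close>
    define t where "t = - c / ?I"
    have c: "c = t * (- ?I)" using I by (simp add: t_def)
    have d: "d = t * ?J" using cd I by (simp add: t_def boundary_system_def field_simps)
    have "u = (\<lambda>x. t * e x)"
      unfolding u e_def radial_on_disc_def c d by (simp add: fun_eq_iff algebra_simps)
    then show "u \<in> range (\<lambda>t x. t * e x)" by blast
  next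
    fix u assume "u \<in> range (\<lambda>t x. t * e x)"
    then obtain t where "u = (\<lambda>x. t * e x)" by blast
    then have "u = radial_on_disc (mode_0 \<kappa> (alpha01 \<kappa>) (t * - ?I) (t * ?J))"
      by (simp add: e_def radial_on_disc_def fun_eq_iff algebra_simps)
    moreover have "boundary_system \<kappa> (alpha01 \<kappa>) (t * - ?I) (t * ?J)"
    proof -
      have "t * - ?I * x + t * ?J * y = t * (- ?I * x + ?J * y)" for x y by (simp add: algebra_simps)
      then show ?thesis using bs unfolding boundary_system_iff by simp
    qed
    ultimately show "u \<in> {radial_on_disc (mode_0 \<kappa> (alpha01 \<kappa>) c d) | c d. boundary_system \<kappa> (alpha01 \<kappa>) c d}"
      by blast
  qed
  then have span: "eigenspace \<kappa> (first_eigenvalue \<kappa>) = real_fun.span {e}"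
    by (simp add: real_fun.span_singleton)
  have "e \<noteq> 0"
  proof
    assume "e = 0"
    then have "\<forall>x. radial_on_disc (mode_0 \<kappa> (alpha01 \<kappa>) (- ?I) ?J) x = 0" by (simp add: e_def fun_eq_iff)
    then show False unfolding radial_eq_0_iff[OF bs] using I by simp
  qed
  then have "real_fun.independent {e}" by (simp add: real_fun.independent_insert)
  then have "real_fun.dim (eigenspace \<kappa> (first_eigenvalue \<kappa>)) = 1"
    unfolding span by (simp add: real_fun.dim_span real_fun.dim_eq_card_independent)
  then show ?thesis
    using eigenvalue_alpha01 by (simp add: simple_eigenvalue_def first_eigenvalue_eq)
qed

end

theorem theorem11:
  shows "(\<forall>\<kappa>>0.
            (0 < alpha01 \<kappa> \<and> F0 \<kappa> (alpha01 \<kappa>) = 0 \<and>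
               (\<forall>\<beta>>0. F0 \<kappa> \<beta> = 0 \<longrightarrow> alpha01 \<kappa> \<le> \<beta>)) \<and>
            (eigenvalue \<kappa> (first_eigenvalue \<kappa>) \<and>
               (\<forall>\<mu>. eigenvalue \<kappa> \<mu> \<longrightarrow> first_eigenvalue \<kappa> \<le> \<mu>)) \<and>
            simple_eigenvalue \<kappa> (first_eigenvalue \<kappa>) \<and>
            first_eigenvalue \<kappa> = (alpha01 \<kappa>)\<^sup>2 - \<kappa>\<^sup>2 / (alpha01 \<kappa>)\<^sup>2 \<and>
            {u. eigenfunction \<kappa> (first_eigenvalue \<kappa>) u} =
              {radial_on_disc (\<lambda>r. c * bessel_J 0 (alpha01 \<kappa> * r)
                                 + d * bessel_I 0 (\<kappa> / alpha01 \<kappa> * r)) | c d.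
                 (c, d) \<noteq> (0, 0) \<and> boundary_system \<kappa> (alpha01 \<kappa>) c d})
       \<and> strict_antimono_on {0<..} first_eigenvalue
       \<and> (first_eigenvalue \<longlongrightarrow> (bessel_J_root 1 1)\<^sup>2) (at_right 0)
       \<and> filterlim first_eigenvalue at_bot at_top"
proof (intro conjI allI impI)
  show "strict_antimono_on {0<..} first_eigenvalue"
    using strict_antimono_eigenvalue by (simp add: monotone_on_def first_eigenvalue_eq)
  \<comment> \<open>The formula for the eigenvalue is available for \<kappa> > 0, which holds
    eventually in both filters.\<close>
  have "\<forall>\<^sub>F \<kappa> in at_right 0. (0::real) < \<kappa>" by (rule eventually_at_right_less)
  then have "\<forall>\<^sub>F \<kappa> in at_right 0. (alpha01 \<kappa>)\<^sup>2 - \<kappa>\<^sup>2 / (alpha01 \<kappa>)\<^sup>2 = first_eigenvalue \<kappa>"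
    by eventually_elim (simp add: first_eigenvalue_eq)
  with tendsto_eigenvalue_at_right_0 show "(first_eigenvalue \<longlongrightarrow> (bessel_J_root 1 1)\<^sup>2) (at_right 0)"
    by (rule Lim_transform_eventually)
  have "\<forall>\<^sub>F \<kappa> in at_top. (0::real) < \<kappa>" by (rule eventually_gt_at_top)
  then have "\<forall>\<^sub>F \<kappa> in at_top. first_eigenvalue \<kappa> \<le> (alpha01 \<kappa>)\<^sup>2 - \<kappa>\<^sup>2 / (alpha01 \<kappa>)\<^sup>2"
    by eventually_elim (simp add: first_eigenvalue_eq)
  with filterlim_eigenvalue_at_top show "filterlim first_eigenvalue at_bot at_top"
    by (rule filterlim_at_bot_mono)
next
  fix \<kappa> :: real assume \<kappa>: "0 < \<kappa>"
  show "0 < alpha01 \<kappa>" "F0 \<kappa> (alpha01 \<kappa>) = 0" by (rule alpha01_pos[OF \<kappa>], rule F0_alpha01[OF \<kappa>])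
  show "alpha01 \<kappa> \<le> \<beta>" if "0 < \<beta>" "F0 \<kappa> \<beta> = 0" for \<beta>
    using F0_pos[OF \<kappa> that(1)] that(2) by force
  show "eigenvalue \<kappa> (first_eigenvalue \<kappa>)"
    using eigenvalue_alpha01[OF \<kappa>] by (simp only: first_eigenvalue_eq[OF \<kappa>])
  show "first_eigenvalue \<kappa> \<le> \<mu>" if "eigenvalue \<kappa> \<mu>" for \<mu>
    using eigenvalue_ge[OF \<kappa> that] by (simp only: first_eigenvalue_eq[OF \<kappa>])
  show "simple_eigenvalue \<kappa> (first_eigenvalue \<kappa>)" by (rule simple_first_eigenvalue[OF \<kappa>])
  show "first_eigenvalue \<kappa> = (alpha01 \<kappa>)\<^sup>2 - \<kappa>\<^sup>2 / (alpha01 \<kappa>)\<^sup>2" by (rule first_eigenvalue_eq[OF \<kappa>])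
  show "{u. eigenfunction \<kappa> (first_eigenvalue \<kappa>) u} =
              {radial_on_disc (\<lambda>r. c * bessel_J 0 (alpha01 \<kappa> * r)
                                 + d * bessel_I 0 (\<kappa> / alpha01 \<kappa> * r)) | c d.
                 (c, d) \<noteq> (0, 0) \<and> boundary_system \<kappa> (alpha01 \<kappa>) c d}"
    unfolding first_eigenvalue_eq[OF \<kappa>] by (rule eigenfunctions_alpha01[OF \<kappa>])
qed

end
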